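(* Assume that $c\in C^1(\Omega^2)$, $\rho,\rho^*\in\mathscr{P}(\Omega)$, and $$\operatorname{supp}(\rho)=\operatorname{cl}(\operatorname{int}(\operatorname{supp}(\rho))).$$ Let $\{O_k\}$ be the connected components of $\operatorname{int}(\operatorname{supp}(\rho))$, and assume that all the sets $\{\operatorname{cl}(O_k)\}$ are mutually linked in the optimal transportation from $\rho$ to $\rho^*$ with transport cost $c$. Then $\phi_2-\phi_1$ is constant $\rho$-a.e. for all pairs of Kantorovich potentials $(\phi_1,\psi_1)$, $(\phi_2,\psi_2)$ for the transport from $\rho$ to $\rho^*$.
   Context: Setting: $\Omega\subset\mathbb{R}^d$ is compact, and $\mathscr{P}(\Omega)$ is the set of Borel probability measures on $\Omega$; $\operatorname{int}$ and $\operatorname{cl}$ denote interior and closure. Optimal transport: for $\mu,\nu\in\mathscr{P}(\Omega)$, $\mathcal{T}_c(\mu,\nu)=\inf_\pi\int_{\Omega\times\Omega}c\,d\pi$ over all $\pi\in\mathscr{P}(\Omega\times\Omega)$ with marginals $\mu$ and $\nu$; $\Gamma_0(\mu,\nu)$ is the set of minimizers (optimal transport plans). $\Phi_c(\mu,\nu)\subset C(\Omega)\times C(\Omega)$ is the set of pairs $(\phi,\psi)$ with $\phi(x)+\psi(y)\le c(x,y)$ for all $(x,y)\in\Omega^2$. Kantorovich duality states $\mathcal{T}_c(\mu,\nu)=\sup_{(\phi,\psi)\in\Phi_c(\mu,\nu)}\int\phi\,d\mu+\int\psi\,d\nu$; maximizing pairs are called Kantorovich potentials. Linked components: write $\operatorname{int}(\operatorname{supp}(\rho))=\bigcup_kO_k$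 with $O_k$ disjoint, open and connected (the connected components), and set $$E_k=\operatorname{cl}\big(\{y:(x,y)\in\operatorname{supp}(\pi)\text{ for some }x\in\operatorname{cl}(O_k),\ \pi\in\Gamma_0(\rho,\rho^* )\}\big).$$ $\operatorname{cl}(O_k)$ and $\operatorname{cl}(O_l)$ are linked in the optimal transportation from $\rho$ to $\rho^*$ with transport cost $c$ if there exist indices $i_1,\dots,i_N$ with $k=i_1$, $l=i_N$, and $E_{i_j}\cap E_{i_{j+1}}\ne\emptyset$ for $1\le j\le N-1$. *)

theory Defs
  imports "HOL-Probability.Probability"
begin

(* C^1 on a set S that need not be open: differentiable at each point of S, relative to S, with a
   continuous choice of derivative. Every function that is C^1 on an open neighbourhood of S
   is C^1 on S in this sense. *)
definition C1_on :: "('a::real_normed_vector \<Rightarrow> real) \<Rightarrow> 'a set \<Rightarrow> bool" where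
  "C1_on f S \<longleftrightarrow>
     (\<exists>D :: 'a \<Rightarrow> 'a \<Rightarrow>\<^sub>L real.
        (\<forall>x\<in>S. (f has_derivative blinfun_apply (D x)) (at x within S)) \<and> continuous_on S D)"

(* Borel probability measures on the subspace S; in particular space \<mu> = S. *)
definition prob_measures_on :: "'a::topological_space set \<Rightarrow> 'a measure set" where
  "prob_measures_on S = {\<mu>. prob_space \<mu> \<and> sets \<mu> = sets (restrict_space borel S)}"

definition supp :: "'a::topological_space measure \<Rightarrow> 'a set" where
  "supp \<mu> = {x \<in> space \<mu>. \<forall>U. open U \<and> x \<in> U \<longrightarrow> emeasure \<mu> (U \<inter> space \<mu>) > 0}"

definition transport_plans ::
  "'a::topological_space set \<Rightarrow> 'a measure \<Rightarrow> 'a measure \<Rightarrow> ('a \<times> 'a) measure set" where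
  "transport_plans \<Omega> \<mu> \<nu> =
     {\<pi> \<in> prob_measures_on (\<Omega> \<times> \<Omega>). distr \<pi> \<mu> fst = \<mu> \<and> distr \<pi> \<nu> snd = \<nu>}"

(* The real-valued infimum is the intended one when c is continuous on the compact \<Omega> \<times> \<Omega>: the
   costs are then bounded below, and the product measure is a transport plan. *)
definition transport_cost ::
  "'a::topological_space set \<Rightarrow> ('a \<times> 'a \<Rightarrow> real) \<Rightarrow> 'a measure \<Rightarrow> 'a measure \<Rightarrow> real" where
  "transport_cost \<Omega> c \<mu> \<nu> = (INF \<pi>\<in>transport_plans \<Omega> \<mu> \<nu>. \<integral>z. c z \<partial>\<pi>)"

definition optimal_plans ::
  "'a::topological_space set \<Rightarrow> ('a \<times> 'a \<Rightarrow> real) \<Rightarrow> 'a measure \<Rightarrow> 'a measure \<Rightarrow> ('a \<times> 'a) measure set"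
  where
  "optimal_plans \<Omega> c \<mu> \<nu> =
     {\<pi> \<in> transport_plans \<Omega> \<mu> \<nu>. (\<integral>z. c z \<partial>\<pi>) = transport_cost \<Omega> c \<mu> \<nu>}"

definition dual_admissible ::
  "'a::topological_space set \<Rightarrow> ('a \<times> 'a \<Rightarrow> real) \<Rightarrow> (('a \<Rightarrow> real) \<times> ('a \<Rightarrow> real)) set" where
  "dual_admissible \<Omega> c =
     {(\<phi>, \<psi>). continuous_on \<Omega> \<phi> \<and> continuous_on \<Omega> \<psi> \<and>
              (\<forall>x\<in>\<Omega>. \<forall>y\<in>\<Omega>. \<phi> x + \<psi> y \<le> c (x, y))}"

definition kantorovich_potentials ::
  "'a::topological_space set \<Rightarrow> ('a \<times> 'a \<Rightarrow> real) \<Rightarrow> 'a measure \<Rightarrow> 'a measure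
     \<Rightarrow> (('a \<Rightarrow> real) \<times> ('a \<Rightarrow> real)) set" where
  "kantorovich_potentials \<Omega> c \<mu> \<nu> =
     {(\<phi>, \<psi>). (\<phi>, \<psi>) \<in> dual_admissible \<Omega> c \<and>
        (\<forall>(\<phi>', \<psi>') \<in> dual_admissible \<Omega> c.
           (\<integral>x. \<phi>' x \<partial>\<mu>) + (\<integral>y. \<psi>' y \<partial>\<nu>) \<le> (\<integral>x. \<phi> x \<partial>\<mu>) + (\<integral>y. \<psi> y \<partial>\<nu>))}"

(* The set E_k for the component A = O_k. *)
definition target_set ::
  "'a::topological_space set \<Rightarrow> ('a \<times> 'a \<Rightarrow> real) \<Rightarrow> 'a measure \<Rightarrow> 'a measure \<Rightarrow> 'a set \<Rightarrow> 'a set"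
  where
  "target_set \<Omega> c \<mu> \<nu> A =
     closure {y. \<exists>x \<pi>. x \<in> closure A \<and> \<pi> \<in> optimal_plans \<Omega> c \<mu> \<nu> \<and> (x, y) \<in> supp \<pi>}"

(* The components O_k serve as their own indices: the list Os plays the role of i_1, ..., i_N. *)
definition linked ::
  "'a::topological_space set \<Rightarrow> ('a \<times> 'a \<Rightarrow> real) \<Rightarrow> 'a measure \<Rightarrow> 'a measure
     \<Rightarrow> 'a set \<Rightarrow> 'a set \<Rightarrow> bool" where
  "linked \<Omega> c \<mu> \<nu> A B \<longleftrightarrow>
     (\<exists>Os. Os \<noteq> [] \<and> set Os \<subseteq> components (interior (supp \<mu>)) \<and> hd Os = A \<and> last Os = B \<and>
        (\<forall>j. Suc j < length Os \<longrightarrow>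
           target_set \<Omega> c \<mu> \<nu> (Os ! j) \<inter> target_set \<Omega> c \<mu> \<nu> (Os ! Suc j) \<noteq> {}))"

end

theory Submission
  imports Defs "HOL-Complex_Analysis.Great_Picard"
begin

text \<open>
  Put \<open>f = \<phi>2 - \<phi>1\<close>. Two mechanisms force \<open>f\<close> to be constant on the support of \<open>\<rho>\<close>.

  Inside a component of the interior of the support, first-order information determines a potential.
  Every point \<open>x\<close> of the support has a partner \<open>y\<close> with \<open>\<phi> x + \<psi> y = c (x, y)\<close>, because otherwise
  \<open>\<phi>\<close> could be increased near \<open>x\<close> (\<open>contact_point_exists\<close>); the average of two optimal pairs is
  optimal, so both pairs share a partner. Then \<open>\<phi>1\<close> and \<open>\<phi>2\<close> have the same supergradient at \<open>x\<close>, namely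
  the derivative of \<open>c\<close> in its first variable at \<open>(x, y)\<close>. A telescoping argument along segments
  (\<open>common_superderivative_imp_equal_increment\<close>) shows that two functions with a common uniform
  supergradient have equal increments. Hence \<open>f\<close> is constant on each component and on its closure.

  Between components, linking transfers the constant. On the support of an optimal plan both pairs satisfy
  \<open>\<phi> x + \<psi> y = c (x, y)\<close> (\<open>complementary_slackness\<close>), so \<open>f x = \<psi>1 y - \<psi>2 y\<close> there, and
  components whose target sets meet have the same constant. Since the support is the closure of its
  interior and has full measure, \<open>f\<close> is constant almost everywhere.

  Complementary slackness needs strong duality: plans whose cost approaches the dual value must exist.
  They are constructed by entropic regularisation. For \<open>\<epsilon> > 0\<close> there are continuous \<open>u\<close> and \<open>v\<close> such that
  \<open>exp ((u x + v y - c (x, y)) / \<epsilon>)\<close> is the density of a plan (\<open>schroedinger_system\<close>); they come from a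
  maximiser of a concave functional, which exists by equicontinuity. The cost of that plan is at most
  the integral of \<open>u\<close> plus the integral of \<open>v\<close> (\<open>entropic_plan\<close>), while \<open>u x + v y\<close> exceeds the cost by
  an amount that vanishes with \<open>\<epsilon>\<close> (\<open>entropic_near_admissible\<close>), so this sum is nearly a dual value
  (\<open>approximate_duality\<close>).
\<close>

section \<open>Measures on a compact set\<close>

lemma space_prob_measures_on:
  assumes "\<mu> \<in> prob_measures_on S"
  shows "space \<mu> = S"
proof -
  have "sets \<mu> = sets (restrict_space borel S)"
    using assms by (simp add: prob_measures_on_def)
  from sets_eq_imp_space_eq[OF this] show ?thesis
    by (simp add: space_restrict_space)
qed

lemma prob_space_prob_measures_on: "\<mu> \<in> prob_measures_on S \<Longrightarrow> prob_space \<mu>"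
  by (simp add: prob_measures_on_def)

lemma nonempty_prob_measures_on:
  assumes "\<mu> \<in> prob_measures_on S"
  shows "S \<noteq> {}"
  using prob_space.not_empty[OF prob_space_prob_measures_on[OF assms]]
    space_prob_measures_on[OF assms] by simp

lemma measurable_prob_measures_on:
  fixes f :: "'a::topological_space \<Rightarrow> real"
  assumes "\<mu> \<in> prob_measures_on S" "continuous_on S f"
  shows "f \<in> borel_measurable \<mu>"
proof -
  have "sets \<mu> = sets (restrict_space borel S)"
    using assms by (simp add: prob_measures_on_def)
  then show ?thesis
    using borel_measurable_continuous_on_restrict[OF assms(2)] measurable_cong_sets by blast
qed

lemma integrable_continuous_prob_measures_on:
  fixes f :: "'a::topological_space \<Rightarrow> real"
  assumes "\<mu> \<in> prob_measures_on S" "compact S" "continuous_on S f"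
  shows "integrable \<mu> f"
proof -
  interpret prob_space \<mu> by (rule prob_space_prob_measures_on) fact
  have "bounded (f ` S)"
    using compact_continuous_image[OF assms(3,2)] by (rule compact_imp_bounded)
  then obtain B where B: "\<And>x. x \<in> S \<Longrightarrow> norm (f x) \<le> B"
    unfolding bounded_iff by auto
  show ?thesis
    by (rule integrable_const_bound[where B = B])
      (use B assms measurable_prob_measures_on in \<open>auto simp: space_prob_measures_on\<close>)
qed

lemma open_Int_in_sets:
  assumes "\<mu> \<in> prob_measures_on S" "open U"
  shows "U \<inter> S \<in> sets \<mu>"
  using assms by (auto simp: prob_measures_on_def sets_restrict_space)

text \<open>
  Second countability is what makes this true: the complement of the support is a union of null open
  sets, and countably many null basic open sets cover it.
\<close>

lemma AE_in_supp:
  fixes \<mu> :: "'a::second_countable_topology measure"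
  assumes \<mu>: "\<mu> \<in> prob_measures_on S"
  shows "AE x in \<mu>. x \<in> supp \<mu>"
proof -
  obtain B :: "'a set set" where B: "countable B" "topological_basis B"
    using ex_countable_basis by blast
  define N where "N = {b \<in> B. b \<inter> S \<in> null_sets \<mu>}"
  have null: "(\<Union>b\<in>N. b \<inter> S) \<in> null_sets \<mu>"
  proof (rule null_sets_UN')
    show "countable N" using B(1) by (simp add: N_def)
  qed (simp add: N_def)
  have "{x \<in> space \<mu>. x \<notin> supp \<mu>} \<subseteq> (\<Union>b\<in>N. b \<inter> S)"
  proof
    fix x assume "x \<in> {x \<in> space \<mu>. x \<notin> supp \<mu>}"
    then obtain U where U: "open U" "x \<in> U" "emeasure \<mu> (U \<inter> space \<mu>) = 0" "x \<in> space \<mu>"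
      by (auto simp: supp_def not_gr_zero)
    obtain b where b: "b \<in> B" "x \<in> b" "b \<subseteq> U"
      using topological_basisE[OF B(2) U(1,2)] by blast
    have "open b" using B(2) b(1) by (rule topological_basis_open)
    have "emeasure \<mu> (b \<inter> S) \<le> emeasure \<mu> (U \<inter> S)"
      by (rule emeasure_mono) (use b open_Int_in_sets[OF \<mu> U(1)] in auto)
    then have "b \<in> N"
      using b U open_Int_in_sets[OF \<mu> \<open>open b\<close>]
      by (auto simp: N_def null_sets_def space_prob_measures_on[OF \<mu>])
    then show "x \<in> (\<Union>b\<in>N. b \<inter> S)"
      using b U by (auto simp: space_prob_measures_on[OF \<mu>])
  qed
  then show ?thesis by (rule AE_I'[OF null])
qed

text \<open>
  This is how almost-everywhere identities, the natural output of integral arguments, become pointwise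
  identities on supports: a nonzero value persists on a neighbourhood, and a neighbourhood of a
  point of the support carries mass.
\<close>

lemma AE_zero_imp_zero_on_supp:
  fixes f :: "'a::topological_space \<Rightarrow> real"
  assumes \<mu>: "\<mu> \<in> prob_measures_on S" and f: "continuous_on S f"
    and ae: "AE x in \<mu>. f x = 0" and x: "x \<in> supp \<mu>"
  shows "f x = 0"
proof (rule ccontr)
  assume "f x \<noteq> 0"
  obtain U where U: "open U" "U \<inter> S = f -` (- {0}) \<inter> S"
    using f open_delete[OF open_UNIV, of 0] unfolding continuous_on_open_invariant
    by (metis Compl_eq_Diff_UNIV)
  have "x \<in> S" using x by (auto simp: supp_def space_prob_measures_on[OF \<mu>])
  then have "x \<in> U" using U \<open>f x \<noteq> 0\<close> by blast
  then have "emeasure \<mu> (U \<inter> S) > 0"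
    using x U by (auto simp: supp_def space_prob_measures_on[OF \<mu>])
  moreover have "emeasure \<mu> (U \<inter> S) = 0"
  proof (rule emeasure_eq_0_AE[where P = "\<lambda>x. x \<in> U \<inter> S", simplified Collect_mem_eq, THEN trans[rotated]]; (rule refl)?)
    show "AE x in \<mu>. x \<notin> U \<inter> S" using ae by eventually_elim (use U in auto)
    show "emeasure \<mu> (U \<inter> S) = emeasure \<mu> {x \<in> space \<mu>. x \<in> U \<inter> S}"
      by (rule arg_cong[where f = "emeasure \<mu>"]) (auto simp: space_prob_measures_on[OF \<mu>])
  qed
  ultimately show False by simp
qed

text \<open>
  Plans are measures on the Borel \<sigma>-algebra of the product, while product measures and densities live
  on the product \<sigma>-algebra; the two agree for subspaces because they agree for the whole spaces.
\<close>

lemma sets_restrict_borel_Times: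
  fixes A :: "'a::second_countable_topology set" and B :: "'b::second_countable_topology set"
  shows "sets (restrict_space borel A \<Otimes>\<^sub>M restrict_space borel B) = sets (restrict_space borel (A \<times> B))"
    (is "sets ?P = sets ?R")
proof -
  have sp: "space ?P = A \<times> B" "space ?R = A \<times> B"
    by (auto simp: space_pair_measure space_restrict_space)
  have *: "(\<lambda>z. (fst z, snd z)) \<in> ?R \<rightarrow>\<^sub>M ?P"
    by (intro measurable_Pair measurable_restrict_space3) (auto simp: borel_prod[symmetric])
  have 1: "X \<in> sets ?R" if "X \<in> sets ?P" for X
    using measurable_sets[OF * that] sets.sets_into_space[OF that] sp
    by (auto simp: Int_absorb2 vimage_def)
  have "(\<lambda>z. (fst z, snd z)) \<in> ?P \<rightarrow>\<^sub>M (borel :: ('a \<times> 'b) measure)"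
    unfolding borel_prod[symmetric]
    by (intro measurable_Pair measurable_compose[OF measurable_fst] measurable_compose[OF measurable_snd]
        measurable_restrict_space1) auto
  then have *: "(\<lambda>z. z) \<in> ?P \<rightarrow>\<^sub>M ?R"
    by (intro measurable_restrict_space2) (auto simp: sp)
  have 2: "X \<in> sets ?P" if "X \<in> sets ?R" for X
    using measurable_sets[OF * that] sets.sets_into_space[OF that] sp
    by (auto simp: Int_absorb2 vimage_def)
  from 1 2 show ?thesis by blast
qed

lemma sets_pair_prob_measures_on:
  fixes \<mu> \<nu> :: "'a::second_countable_topology measure"
  assumes "\<mu> \<in> prob_measures_on A" "\<nu> \<in> prob_measures_on B"
  shows "sets (\<mu> \<Otimes>\<^sub>M \<nu>) = sets (restrict_space borel (A \<times> B))"
  using assms sets_pair_measure_cong[of \<mu> "restrict_space borel A" \<nu> "restrict_space borel B"]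
  by (simp add: prob_measures_on_def sets_restrict_borel_Times)

lemma pair_prob_measures_on:
  fixes \<mu> \<nu> :: "'a::second_countable_topology measure"
  assumes "\<mu> \<in> prob_measures_on A" "\<nu> \<in> prob_measures_on B"
  shows "\<mu> \<Otimes>\<^sub>M \<nu> \<in> prob_measures_on (A \<times> B)"
proof -
  interpret \<mu>: prob_space \<mu> by (rule prob_space_prob_measures_on) fact
  interpret \<nu>: prob_space \<nu> by (rule prob_space_prob_measures_on) fact
  interpret pair_prob_space \<mu> \<nu> ..
  show ?thesis
    using sets_pair_prob_measures_on[OF assms] P.prob_space_axioms
    by (simp add: prob_measures_on_def)
qed

lemma iterated_integral_prob_measures_on:
  fixes \<mu> \<nu> :: "'a::second_countable_topology measure" and f :: "'a \<Rightarrow> 'a \<Rightarrow> real"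
  assumes \<mu>: "\<mu> \<in> prob_measures_on S" and \<nu>: "\<nu> \<in> prob_measures_on S" and S: "compact S"
    and f: "continuous_on (S \<times> S) (\<lambda>(x, y). f x y)"
  shows "(\<integral>x. (\<integral>y. f x y \<partial>\<nu>) \<partial>\<mu>) = (\<integral>y. (\<integral>x. f x y \<partial>\<mu>) \<partial>\<nu>)"
    and "integrable \<mu> (\<lambda>x. \<integral>y. f x y \<partial>\<nu>)"
    and "(\<integral>(x, y). f x y \<partial>(\<mu> \<Otimes>\<^sub>M \<nu>)) = (\<integral>x. (\<integral>y. f x y \<partial>\<nu>) \<partial>\<mu>)"
proof -
  interpret \<mu>: prob_space \<mu> by (rule prob_space_prob_measures_on) fact
  interpret \<nu>: prob_space \<nu> by (rule prob_space_prob_measures_on) fact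
  interpret pair_prob_space \<mu> \<nu> ..
  have int: "integrable (\<mu> \<Otimes>\<^sub>M \<nu>) (\<lambda>(x, y). f x y)"
    by (rule integrable_continuous_prob_measures_on[OF pair_prob_measures_on[OF \<mu> \<nu>] compact_Times[OF S S] f])
  show "(\<integral>x. (\<integral>y. f x y \<partial>\<nu>) \<partial>\<mu>) = (\<integral>y. (\<integral>x. f x y \<partial>\<mu>) \<partial>\<nu>)"
    using Fubini_integral[OF int] by simp
  show "integrable \<mu> (\<lambda>x. \<integral>y. f x y \<partial>\<nu>)" using integrable_fst[OF int] .
  show "(\<integral>(x, y). f x y \<partial>(\<mu> \<Otimes>\<^sub>M \<nu>)) = (\<integral>x. (\<integral>y. f x y \<partial>\<nu>) \<partial>\<mu>)"
    using integral_fst[OF int] by simp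
qed

lemma continuous_on_slices:
  fixes f :: "'a::topological_space \<Rightarrow> 'b::topological_space \<Rightarrow> 'c::topological_space"
  assumes f: "continuous_on (A \<times> B) (\<lambda>(x, y). f x y)"
  shows "x \<in> A \<Longrightarrow> continuous_on B (f x)" and "y \<in> B \<Longrightarrow> continuous_on A (\<lambda>x. f x y)"
    and "continuous_on (B \<times> A) (\<lambda>(y, x). f x y)"
proof -
  show "continuous_on B (f x)" if "x \<in> A"
  proof -
    have "continuous_on B (\<lambda>y. (x, y))" by (intro continuous_intros)
    from continuous_on_compose2[OF f this] that show ?thesis by auto
  qed
  show "continuous_on A (\<lambda>x. f x y)" if "y \<in> B"
  proof -
    have "continuous_on A (\<lambda>x. (x, y))" by (intro continuous_intros)
    from continuous_on_compose2[OF f this] that show ?thesis by auto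
  qed
  have "continuous_on (B \<times> A) (\<lambda>z. (snd z, fst z))" by (intro continuous_intros)
  from continuous_on_compose2[OF f this]
  have "continuous_on (B \<times> A) (\<lambda>z. f (snd z) (fst z))" by (force simp: case_prod_unfold)
  then show "continuous_on (B \<times> A) (\<lambda>(y, x). f x y)" by (simp add: case_prod_unfold)
qed

text \<open>
  Every regularity statement below about transforms of potentials rests on this modulus: an infimum,
  or a smoothed infimum, of functions of \<open>x\<close> with a common modulus of continuity has the same modulus.
\<close>

lemma continuous_slices_equicontinuous:
  fixes f :: "'a::metric_space \<Rightarrow> 'b::metric_space \<Rightarrow> real"
  assumes "continuous_on (A \<times> B) (\<lambda>(x, y). f x y)" "compact A" "compact B" "e > 0"
  obtains d where "d > 0"
    "\<And>x x' y. x \<in> A \<Longrightarrow> x' \<in> A \<Longrightarrow> y \<in> B \<Longrightarrow> dist x x' < d \<Longrightarrow> \<bar>f x y - f x' y\<bar> < e"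
proof -
  have "uniformly_continuous_on (A \<times> B) (\<lambda>(x, y). f x y)"
    using assms by (intro compact_uniformly_continuous compact_Times)
  from this[unfolded uniformly_continuous_on_def, rule_format, OF \<open>e > 0\<close>]
  obtain d where d: "d > 0" and *: "\<And>z z'. z \<in> A \<times> B \<Longrightarrow> z' \<in> A \<times> B \<Longrightarrow> dist z' z < d \<Longrightarrow>
      dist (case z' of (x, y) \<Rightarrow> f x y) (case z of (x, y) \<Rightarrow> f x y) < e"
    by metis
  show thesis
  proof (rule that[OF d])
    fix x x' y assume "x \<in> A" "x' \<in> A" "y \<in> B" "dist x x' < d"
    then show "\<bar>f x y - f x' y\<bar> < e"
      using *[of "(x', y)" "(x, y)"] by (auto simp: dist_Pair_Pair dist_real_def)
  qed
qed

section \<open>Entropic regularisation of optimal transport\<close>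

text \<open>
  The log-sum-exp smoothing of the \<open>c\<close>-transform: as \<open>\<epsilon>\<close> tends to 0 it approaches the infimum over the
  support of \<open>\<nu>\<close> of \<open>w x y - v y\<close>.
\<close>

definition soft_transform ::
  "real \<Rightarrow> 'a measure \<Rightarrow> ('a \<Rightarrow> 'a \<Rightarrow> real) \<Rightarrow> ('a \<Rightarrow> real) \<Rightarrow> 'a \<Rightarrow> real" where
  "soft_transform \<epsilon> \<nu> w v x = - \<epsilon> * ln (\<integral>y. exp ((v y - w x y) / \<epsilon>) \<partial>\<nu>)"

text \<open>
  Throughout, \<open>exp ((u x + v y - w x y) / \<epsilon>)\<close> is a candidate density of a plan with respect to
  \<open>\<mu> \<Otimes>\<^sub>M \<nu>\<close>. The value of a transform at \<open>x\<close> is the constant that normalises this density in one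
  variable, so solving the two marginal conditions at once means finding a fixed point of alternating
  transforms.
\<close>

locale entropic_transport =
  fixes S :: "'a::euclidean_space set" and \<mu> \<nu> :: "'a measure"
    and w :: "'a \<Rightarrow> 'a \<Rightarrow> real" and \<epsilon> :: real
  assumes compact_S: "compact S"
    and \<mu>: "\<mu> \<in> prob_measures_on S" and \<nu>: "\<nu> \<in> prob_measures_on S"
    and w: "continuous_on (S \<times> S) (\<lambda>(x, y). w x y)"
    and \<epsilon>: "\<epsilon> > 0"
begin

text \<open>
  The situation is symmetric in the two measures; interpreting the locale a second time with the roles
  exchanged gives every fact about \<open>T\<close> for \<open>T'\<close> as well.
\<close>

lemma flip: "entropic_transport S \<nu> \<mu> (\<lambda>y x. w x y) \<epsilon>"
  using compact_S \<mu> \<nu> continuous_on_slices(3)[OF w] \<epsilon> by unfold_locales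

sublocale \<mu>: prob_space \<mu> by (rule prob_space_prob_measures_on[OF \<mu>])
sublocale \<nu>: prob_space \<nu> by (rule prob_space_prob_measures_on[OF \<nu>])

abbreviation T :: "('a \<Rightarrow> real) \<Rightarrow> 'a \<Rightarrow> real" where
  "T \<equiv> soft_transform \<epsilon> \<nu> w"

abbreviation T' :: "('a \<Rightarrow> real) \<Rightarrow> 'a \<Rightarrow> real" where
  "T' \<equiv> soft_transform \<epsilon> \<mu> (\<lambda>y x. w x y)"

lemmas integrable_\<mu> = integrable_continuous_prob_measures_on[OF \<mu> compact_S]
lemmas integrable_\<nu> = integrable_continuous_prob_measures_on[OF \<nu> compact_S]
lemmas space_\<mu> = space_prob_measures_on[OF \<mu>]
lemmas space_\<nu> = space_prob_measures_on[OF \<nu>]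

lemma continuous_kernel:
  assumes "continuous_on S v" "x \<in> S"
  shows "continuous_on S (\<lambda>y. exp ((a + v y - w x y) / \<epsilon>))"
  using \<epsilon> by (intro continuous_intros assms continuous_on_slices(1)[OF w]) auto

lemma continuous_kernel2:
  assumes "continuous_on S u" "continuous_on S v"
  shows "continuous_on (S \<times> S) (\<lambda>(x, y). exp ((u x + v y - w x y) / \<epsilon>))"
proof -
  have "continuous_on (S \<times> S) (\<lambda>z. exp ((u (fst z) + v (snd z) - (case z of (x, y) \<Rightarrow> w x y)) / \<epsilon>))"
    using \<epsilon> by (intro continuous_intros w continuous_on_compose2[OF assms(1)]
      continuous_on_compose2[OF assms(2)]) auto
  then show ?thesis by (simp add: case_prod_unfold)
qed

lemma integrable_kernel:
  assumes "continuous_on S v" "x \<in> S"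
  shows "integrable \<nu> (\<lambda>y. exp ((a + v y - w x y) / \<epsilon>))"
  by (rule integrable_\<nu>[OF continuous_kernel[OF assms]])

lemma kernel_pos:
  assumes "continuous_on S v" "x \<in> S"
  shows "(\<integral>y. exp ((a + v y - w x y) / \<epsilon>) \<partial>\<nu>) > 0"
proof -
  let ?f = "\<lambda>y. exp ((a + v y - w x y) / \<epsilon>)"
  have "(\<integral>y. ?f y \<partial>\<nu>) \<noteq> 0"
    using integral_nonneg_eq_0_iff_AE[OF integrable_kernel[OF assms, of a]] by simp
  moreover have "(\<integral>y. ?f y \<partial>\<nu>) \<ge> 0" by (rule Bochner_Integration.integral_nonneg) auto
  ultimately show ?thesis by linarith
qed

lemma kernel_shift:
  "(\<integral>y. exp ((a + v y - w x y) / \<epsilon>) \<partial>\<nu>) = exp (a / \<epsilon>) * (\<integral>y. exp ((v y - w x y) / \<epsilon>) \<partial>\<nu>)"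
proof -
  have "exp ((a + v y - w x y) / \<epsilon>) = exp (a / \<epsilon>) * exp ((v y - w x y) / \<epsilon>)" for y
    by (simp add: exp_add[symmetric] add_divide_distrib diff_divide_distrib)
  then show ?thesis by simp
qed

lemma ln_kernel:
  assumes "continuous_on S v" "x \<in> S"
  shows "\<epsilon> * ln (\<integral>y. exp ((a + v y - w x y) / \<epsilon>) \<partial>\<nu>) = a - T v x"
proof -
  have "(\<integral>y. exp ((v y - w x y) / \<epsilon>) \<partial>\<nu>) > 0" using kernel_pos[OF assms, of 0] by simp
  then show ?thesis
    using \<epsilon> by (simp add: kernel_shift soft_transform_def ln_mult distrib_left)
qed

lemma soft_transform_normalises:
  assumes "continuous_on S v" "x \<in> S"
  shows "(\<integral>y. exp ((T v x + v y - w x y) / \<epsilon>) \<partial>\<nu>) = 1"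
  using ln_kernel[OF assms, of "T v x"] \<epsilon> kernel_pos[OF assms, of "T v x"] by auto

lemma soft_transform_unique:
  assumes "continuous_on S v" "x \<in> S" "(\<integral>y. exp ((a + v y - w x y) / \<epsilon>) \<partial>\<nu>) = 1"
  shows "a = T v x"
  using ln_kernel[OF assms(1,2), of a] assms(3) by simp

text \<open>
  The one comparison principle behind the modulus of continuity in the point, the nonexpansiveness in
  the potential and the continuity of transforms: an additive error \<open>\<delta>\<close> in the exponent becomes an
  additive error \<open>\<delta>\<close> in the transform, whatever \<open>\<epsilon>\<close> is.
\<close>

lemma soft_transform_antimono:
  assumes v: "continuous_on S v" "x \<in> S" and v': "continuous_on S v'" "x' \<in> S"
    and le: "\<And>y. y \<in> S \<Longrightarrow> v y - w x y \<le> v' y - w x' y + \<delta>"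
  shows "T v' x' \<le> T v x + \<delta>"
proof -
  let ?a = "T v' x'"
  have "(\<integral>y. exp ((?a - \<delta> + v y - w x y) / \<epsilon>) \<partial>\<nu>) \<le> (\<integral>y. exp ((?a + v' y - w x' y) / \<epsilon>) \<partial>\<nu>)"
  proof (rule integral_mono)
    fix y assume "y \<in> space \<nu>"
    then show "exp ((?a - \<delta> + v y - w x y) / \<epsilon>) \<le> exp ((?a + v' y - w x' y) / \<epsilon>)"
      using le[of y] \<epsilon> by (auto simp: space_\<nu> intro!: divide_right_mono)
  qed (intro integrable_kernel v v')+
  then have "(\<integral>y. exp ((?a - \<delta> + v y - w x y) / \<epsilon>) \<partial>\<nu>) \<le> 1"
    by (simp add: soft_transform_normalises[OF v'])
  then have "\<epsilon> * ln (\<integral>y. exp ((?a - \<delta> + v y - w x y) / \<epsilon>) \<partial>\<nu>) \<le> 0"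
    using kernel_pos[OF v, of "?a - \<delta>"] \<epsilon> by (intro mult_nonneg_nonpos) auto
  then show ?thesis by (simp add: ln_kernel[OF v])
qed

lemma soft_transform_modulus:
  assumes "continuous_on S v" "x \<in> S" "x' \<in> S"
    and "\<And>y. y \<in> S \<Longrightarrow> \<bar>w x y - w x' y\<bar> \<le> \<delta>"
  shows "\<bar>T v x - T v x'\<bar> \<le> \<delta>"
  using soft_transform_antimono[OF assms(1,2) assms(1,3), of \<delta>]
    soft_transform_antimono[OF assms(1,3) assms(1,2), of \<delta>] assms(4)
  by (fastforce simp: abs_le_iff)

lemma soft_transform_nonexpansive:
  assumes "continuous_on S v" "continuous_on S v'" "x \<in> S"
    and "\<And>y. y \<in> S \<Longrightarrow> \<bar>v y - v' y\<bar> \<le> \<delta>"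
  shows "\<bar>T v x - T v' x\<bar> \<le> \<delta>"
  using soft_transform_antimono[OF assms(1,3) assms(2,3), of \<delta>]
    soft_transform_antimono[OF assms(2,3) assms(1,3), of \<delta>] assms(4)
  by (fastforce simp: abs_le_iff)

lemma soft_transform_shift:
  assumes "continuous_on S v" "x \<in> S"
  shows "T (\<lambda>y. v y - a) x = T v x + a"
proof (rule soft_transform_unique[symmetric])
  show "(\<integral>y. exp ((T v x + a + (v y - a) - w x y) / \<epsilon>) \<partial>\<nu>) = 1"
    using soft_transform_normalises[OF assms] by (simp add: algebra_simps)
qed (intro continuous_intros assms)+

lemma continuous_soft_transform:
  assumes v: "continuous_on S v"
  shows "continuous_on S (T v)"
  unfolding continuous_on_iff
proof (intro ballI allI impI)
  fix x and e :: real assume x: "x \<in> S" "e > 0"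
  obtain d where "d > 0" and d: "\<And>x x' y. x \<in> S \<Longrightarrow> x' \<in> S \<Longrightarrow> y \<in> S \<Longrightarrow> dist x x' < d \<Longrightarrow>
      \<bar>w x y - w x' y\<bar> < e / 2"
    using continuous_slices_equicontinuous[OF w compact_S compact_S, of "e / 2"] x by auto
  have "dist (T v x') (T v x) < e" if "x' \<in> S" "dist x' x < d" for x'
    using soft_transform_modulus[OF v that(1) x(1), of "e / 2"] d[OF that(1) x(1) _ that(2)] x(2)
    by (force simp: dist_real_def)
  then show "\<exists>d>0. \<forall>x'\<in>S. dist x' x < d \<longrightarrow> dist (T v x') (T v x) < e"
    using \<open>d > 0\<close> by blast
qed

text \<open>
  The entropic dual functional, already maximised over the first potential and up to the constant
  \<open>\<epsilon>\<close>, so that only one function remains to be optimised.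
\<close>

definition J :: "('a \<Rightarrow> real) \<Rightarrow> real" where
  "J v = (\<integral>x. T v x \<partial>\<mu>) + (\<integral>y. v y \<partial>\<nu>)"

text \<open>
  Since \<open>1 + s \<le> exp s\<close>, the normalisation of the kernel bounds \<open>T v x\<close> plus the integral of \<open>v\<close> by
  the integral of \<open>w x\<close>.
\<close>

lemma J_bounded:
  assumes v: "continuous_on S v"
  shows "J v \<le> (\<integral>x. (\<integral>y. w x y \<partial>\<nu>) \<partial>\<mu>)"
proof -
  have "T v x \<le> (\<integral>y. w x y \<partial>\<nu>) - (\<integral>y. v y \<partial>\<nu>)" if x: "x \<in> S" for x
  proof -
    have iw: "integrable \<nu> (w x)" by (rule integrable_\<nu>[OF continuous_on_slices(1)[OF w x]])
    have "(\<integral>y. 1 + (T v x + v y - w x y) / \<epsilon> \<partial>\<nu>) \<le> (\<integral>y. exp ((T v x + v y - w x y) / \<epsilon>) \<partial>\<nu>)"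
      by (rule integral_mono)
        (use \<epsilon> in \<open>auto intro!: integrable_kernel v x integrable_\<nu> continuous_intros
            continuous_on_slices(1)[OF w x]\<close>)
    also have "(\<integral>y. 1 + (T v x + v y - w x y) / \<epsilon> \<partial>\<nu>)
        = 1 + (T v x + (\<integral>y. v y \<partial>\<nu>) - (\<integral>y. w x y \<partial>\<nu>)) / \<epsilon>"
      using iw integrable_\<nu>[OF v] by (simp add: \<nu>.prob_space)
    also note soft_transform_normalises[OF v x]
    finally show ?thesis using \<epsilon> by (simp add: field_simps)
  qed
  then have "(\<integral>x. T v x \<partial>\<mu>) \<le> (\<integral>x. (\<integral>y. w x y \<partial>\<nu>) - (\<integral>y. v y \<partial>\<nu>) \<partial>\<mu>)"
    by (intro integral_mono integrable_\<mu>[OF continuous_soft_transform[OF v]]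
        Bochner_Integration.integrable_diff iterated_integral_prob_measures_on(2)[OF \<mu> \<nu> compact_S w])
      (auto simp: space_\<mu>)
  also have "\<dots> = (\<integral>x. (\<integral>y. w x y \<partial>\<nu>) \<partial>\<mu>) - (\<integral>y. v y \<partial>\<nu>)"
    using iterated_integral_prob_measures_on(2)[OF \<mu> \<nu> compact_S w] by (simp add: \<mu>.prob_space)
  finally show ?thesis by (simp add: J_def)
qed

lemma J_shift:
  assumes v: "continuous_on S v"
  shows "J (\<lambda>y. v y - a) = J v"
proof -
  have "(\<integral>x. T (\<lambda>y. v y - a) x \<partial>\<mu>) = (\<integral>x. T v x + a \<partial>\<mu>)"
    by (rule Bochner_Integration.integral_cong) (auto simp: space_\<mu> soft_transform_shift[OF v])
  then show ?thesis
    using integrable_\<mu>[OF continuous_soft_transform[OF v]] integrable_\<nu>[OF v]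
    by (simp add: J_def \<mu>.prob_space \<nu>.prob_space)
qed

lemma J_nonexpansive:
  assumes v: "continuous_on S v" and v': "continuous_on S v'"
    and le: "\<And>y. y \<in> S \<Longrightarrow> \<bar>v y - v' y\<bar> \<le> \<delta>"
  shows "J v \<le> J v' + 2 * \<delta>"
proof -
  have "(\<integral>x. T v x \<partial>\<mu>) \<le> (\<integral>x. T v' x + \<delta> \<partial>\<mu>)"
    using soft_transform_nonexpansive[OF v v' _ le]
    by (intro integral_mono Bochner_Integration.integrable_add
        integrable_\<mu>[OF continuous_soft_transform[OF v]] integrable_\<mu>[OF continuous_soft_transform[OF v']])
      (force simp: space_\<mu> abs_le_iff)+
  moreover have "(\<integral>x. v x \<partial>\<nu>) \<le> (\<integral>x. v' x + \<delta> \<partial>\<nu>)"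
    using le by (intro integral_mono Bochner_Integration.integrable_add integrable_\<nu>[OF v] integrable_\<nu>[OF v'])
      (force simp: space_\<nu> abs_le_iff)+
  ultimately show ?thesis
    using integrable_\<mu>[OF continuous_soft_transform[OF v']] integrable_\<nu>[OF v']
    by (simp add: J_def \<mu>.prob_space \<nu>.prob_space)
qed

end

context entropic_transport begin

lemma kernel_value:
  assumes "continuous_on S v" "x \<in> S"
  shows "(\<integral>y. exp ((a + v y - w x y) / \<epsilon>) \<partial>\<nu>) = exp ((a - T v x) / \<epsilon>)"
  using kernel_shift[of "a - T v x" "\<lambda>y. T v x + v y" x] soft_transform_normalises[OF assms]
  by (simp add: algebra_simps)

text \<open>
  The function \<open>exp ((v y - T' (T v) y) / \<epsilon>)\<close> is the density of the second marginal of the measure whose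
  first marginal was normalised by \<open>T v\<close>; its total mass is 1 by exchanging integrals.
\<close>

lemma soft_transform_gap:
  assumes v: "continuous_on S v"
  shows "(\<integral>y. exp ((v y - T' (T v) y) / \<epsilon>) \<partial>\<nu>) = 1"
proof -
  interpret fl: entropic_transport S \<nu> \<mu> "\<lambda>y x. w x y" \<epsilon> by (rule flip)
  note Tv = continuous_soft_transform[OF v]
  have "(\<integral>y. exp ((v y - T' (T v) y) / \<epsilon>) \<partial>\<nu>) = (\<integral>y. (\<integral>x. exp ((v y + T v x - w x y) / \<epsilon>) \<partial>\<mu>) \<partial>\<nu>)"
    by (rule Bochner_Integration.integral_cong) (auto simp: space_\<nu> fl.kernel_value[OF Tv])
  also have "\<dots> = (\<integral>x. (\<integral>y. exp ((T v x + v y - w x y) / \<epsilon>) \<partial>\<nu>) \<partial>\<mu>)"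
    unfolding iterated_integral_prob_measures_on(1)[OF \<mu> \<nu> compact_S continuous_kernel2[OF Tv v]]
    by (simp add: add.commute)
  also have "\<dots> = (\<integral>x. 1 \<partial>\<mu>)"
    by (rule Bochner_Integration.integral_cong) (auto simp: space_\<mu> soft_transform_normalises[OF v])
  finally show ?thesis by (simp add: \<mu>.prob_space)
qed

text \<open>
  Replacing \<open>v\<close> by \<open>T' (T v)\<close> is one round of Sinkhorn's alternating normalisation. Afterwards the
  first marginal has a density \<open>A\<close> with respect to \<open>\<mu>\<close>, of integral 1 but perhaps not constant. The
  next transform differs from \<open>T v\<close> by \<open>- \<epsilon> * ln A\<close>, which is at least \<open>\<epsilon> * (1 - A)\<close> and so has
  nonnegative integral.
\<close>

lemma J_ascent:
  assumes v: "continuous_on S v"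
  shows "J v + (\<integral>y. T' (T v) y - v y \<partial>\<nu>) \<le> J (T' (T v))"
proof -
  interpret fl: entropic_transport S \<nu> \<mu> "\<lambda>y x. w x y" \<epsilon> by (rule flip)
  define u v2 where "u = T v" and "v2 = T' u"
  have u: "continuous_on S u" unfolding u_def by (rule continuous_soft_transform[OF v])
  have v2: "continuous_on S v2" unfolding v2_def by (rule fl.continuous_soft_transform[OF u])
  let ?A = "\<lambda>x. \<integral>y. exp ((u x + v2 y - w x y) / \<epsilon>) \<partial>\<nu>"
  note it = iterated_integral_prob_measures_on[OF \<mu> \<nu> compact_S continuous_kernel2[OF u v2]]
  have "(\<integral>x. ?A x \<partial>\<mu>) = (\<integral>y. (\<integral>x. exp ((v2 y + u x - w x y) / \<epsilon>) \<partial>\<mu>) \<partial>\<nu>)"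
    unfolding it(1) by (simp add: add.commute)
  also have "\<dots> = (\<integral>y. 1 \<partial>\<nu>)"
    by (rule Bochner_Integration.integral_cong)
      (auto simp: space_\<nu> v2_def fl.soft_transform_normalises[OF u])
  finally have A: "(\<integral>x. ?A x \<partial>\<mu>) = 1" by (simp add: \<nu>.prob_space)
  have le: "u x + \<epsilon> * (1 - ?A x) \<le> T v2 x" if x: "x \<in> S" for x
  proof -
    have "\<epsilon> * ln (?A x) \<le> \<epsilon> * (?A x - 1)"
      using \<epsilon> ln_le_minus_one[OF kernel_pos[OF v2 x, of "u x"]] by simp
    then show ?thesis unfolding ln_kernel[OF v2 x] by (simp add: algebra_simps)
  qed
  have "(\<integral>x. u x + \<epsilon> * (1 - ?A x) \<partial>\<mu>) \<le> (\<integral>x. T v2 x \<partial>\<mu>)"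
    by (intro integral_mono integrable_\<mu>[OF continuous_soft_transform[OF v2]] integrable_\<mu>[OF u]
        Bochner_Integration.integrable_add Bochner_Integration.integrable_diff integrable_mult_right it(2))
      (auto simp: space_\<mu> le)
  moreover have "(\<integral>x. u x + \<epsilon> * (1 - ?A x) \<partial>\<mu>) = (\<integral>x. u x \<partial>\<mu>)"
    using it(2) integrable_\<mu>[OF u] A by (simp add: \<mu>.prob_space)
  ultimately show ?thesis
    using integrable_\<nu>[OF v] integrable_\<nu>[OF v2]
    unfolding J_def u_def[symmetric] v2_def[symmetric] by simp
qed

text \<open>
  With \<open>s = (v - T' (T v)) / \<epsilon>\<close>, the gap lemma says that \<open>exp s\<close> has integral 1, so the
  nonnegative function \<open>exp s - 1 - s\<close> has integral \<open>- \<integral> s\<close>. It vanishes only where \<open>s = 0\<close>.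
\<close>

lemma integral_soft_transform_gap_nonneg:
  assumes v: "continuous_on S v"
  shows "0 \<le> (\<integral>y. T' (T v) y - v y \<partial>\<nu>)"
    and "(\<integral>y. T' (T v) y - v y \<partial>\<nu>) \<le> 0 \<Longrightarrow> AE y in \<nu>. T' (T v) y = v y"
proof -
  interpret fl: entropic_transport S \<nu> \<mu> "\<lambda>y x. w x y" \<epsilon> by (rule flip)
  define v2 where "v2 = T' (T v)"
  have v2: "continuous_on S v2" unfolding v2_def
    by (intro fl.continuous_soft_transform continuous_soft_transform v)
  let ?s = "\<lambda>y. (v y - v2 y) / \<epsilon>"
  have int: "integrable \<nu> (\<lambda>y. exp (?s y) - 1 - ?s y)"
    using \<epsilon> by (intro integrable_\<nu> continuous_intros v v2) auto
  have i1: "integrable \<nu> (\<lambda>y. exp (?s y))" "integrable \<nu> ?s"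
    using \<epsilon> by (auto intro!: integrable_\<nu> continuous_intros v v2)
  have eq: "(\<integral>y. exp (?s y) - 1 - ?s y \<partial>\<nu>) = (\<integral>y. v2 y - v y \<partial>\<nu>) / \<epsilon>"
  proof -
    have "(\<integral>y. exp (?s y) - 1 - ?s y \<partial>\<nu>) = - (\<integral>y. ?s y \<partial>\<nu>)"
      using i1 soft_transform_gap[OF v] by (simp add: v2_def \<nu>.prob_space)
    then show ?thesis
      using integrable_\<nu>[OF v] integrable_\<nu>[OF v2] by (simp add: diff_divide_distrib)
  qed
  have nn: "0 \<le> exp (?s y) - 1 - ?s y" for y
    using exp_ge_add_one_self[of "?s y"] by linarith
  have "0 \<le> (\<integral>y. exp (?s y) - 1 - ?s y \<partial>\<nu>)"
    by (rule Bochner_Integration.integral_nonneg) (rule nn)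
  then show *: "0 \<le> (\<integral>y. T' (T v) y - v y \<partial>\<nu>)"
    using \<epsilon> unfolding eq v2_def[symmetric] by (simp add: zero_le_divide_iff)
  assume "(\<integral>y. T' (T v) y - v y \<partial>\<nu>) \<le> 0"
  with * have "(\<integral>y. v2 y - v y \<partial>\<nu>) = 0" by (simp add: v2_def)
  then have "(\<integral>y. exp (?s y) - 1 - ?s y \<partial>\<nu>) = 0" unfolding eq by simp
  then have "AE y in \<nu>. exp (?s y) - 1 - ?s y = 0"
    using integral_nonneg_eq_0_iff_AE[OF int] nn by simp
  then show "AE y in \<nu>. T' (T v) y = v y"
  proof eventually_elim
    fix y assume *: "exp (?s y) - 1 - ?s y = 0"
    then have "ln (exp (?s y)) = exp (?s y) - 1" by simp
    then have "exp (?s y) = 1" by (rule ln_eq_minus_one[OF exp_gt_zero])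
    then have "?s y = 0" by simp
    with \<epsilon> show "T' (T v) y = v y" by (simp add: v2_def)
  qed
qed

text \<open>
  A maximising sequence may be replaced by its double transforms, because these do not decrease \<open>J\<close>,
  and may be shifted to vanish at a base point. Double transforms inherit the modulus of continuity
  and the oscillation of \<open>w\<close>, so the Arzela-Ascoli theorem gives a uniform limit, and \<open>J\<close> is continuous
  for uniform convergence.
\<close>

lemma J_maximiser:
  obtains v where "continuous_on S v" "\<And>v'. continuous_on S v' \<Longrightarrow> J v' \<le> J v"
proof -
  interpret fl: entropic_transport S \<nu> \<mu> "\<lambda>y x. w x y" \<epsilon> by (rule flip)
  let ?C = "{v :: 'a \<Rightarrow> real. continuous_on S v}"
  have bdd: "bdd_above (J ` ?C)" using J_bounded by (auto intro!: bdd_aboveI2)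
  have "(\<lambda>_. 0) \<in> ?C" by (simp add: continuous_on_const)
  then have ne: "?C \<noteq> {}" by blast
  define M where "M = Sup (J ` ?C)"
  have le_M: "J v \<le> M" if "continuous_on S v" for v
    unfolding M_def using that by (intro cSUP_upper bdd) simp
  have "\<exists>v. continuous_on S v \<and> M - inverse (real (Suc n)) < J v" for n
    using less_cSUP_iff[OF ne bdd, of "M - inverse (real (Suc n))"] by (auto simp: M_def)
  then obtain v where v: "\<And>n. continuous_on S (v n)" "\<And>n. M - inverse (real (Suc n)) < J (v n)"
    by metis
  obtain y0 where y0: "y0 \<in> S" using nonempty_prob_measures_on[OF \<mu>] by blast
  define V where "V n y = T' (T (v n)) y - T' (T (v n)) y0" for n y
  have cT: "continuous_on S (T' (T (v n)))" for n
    by (intro fl.continuous_soft_transform continuous_soft_transform v)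
  have cV: "continuous_on S (V n)" for n
    unfolding V_def by (intro continuous_intros cT)
  have JV: "M - inverse (real (Suc n)) < J (V n)" for n
  proof -
    have "J (v n) \<le> J (T' (T (v n)))"
      using J_ascent[OF v(1)[of n]] integral_soft_transform_gap_nonneg(1)[OF v(1)[of n]] by linarith
    also have "\<dots> = J (V n)" unfolding V_def by (rule J_shift[OF cT, symmetric])
    finally show ?thesis using v(2)[of n] by linarith
  qed
  have modulus: "\<bar>V n y - V n y'\<bar> \<le> \<delta>"
    if "y \<in> S" "y' \<in> S" "\<And>x. x \<in> S \<Longrightarrow> \<bar>w x y - w x y'\<bar> \<le> \<delta>" for n y y' \<delta>
    unfolding V_def using fl.soft_transform_modulus[OF continuous_soft_transform[OF v(1)] that] by simp
  have "bounded ((\<lambda>(x, y). w x y) ` (S \<times> S))"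
    by (intro compact_imp_bounded compact_continuous_image w compact_Times compact_S)
  then obtain B where B: "\<And>x y. x \<in> S \<Longrightarrow> y \<in> S \<Longrightarrow> \<bar>w x y\<bar> \<le> B"
    unfolding bounded_iff by fastforce
  have bound: "norm (V n y) \<le> 2 * B" if "y \<in> S" for n y
  proof -
    have "\<bar>w x y - w x y0\<bar> \<le> 2 * B" if "x \<in> S" for x
      using B[OF that \<open>y \<in> S\<close>] B[OF that y0] by linarith
    from modulus[OF \<open>y \<in> S\<close> y0 this, of n] show ?thesis by (simp add: V_def)
  qed
  have equi: "\<exists>d. 0 < d \<and> (\<forall>n y'. y' \<in> S \<and> norm (y - y') < d \<longrightarrow> norm (V n y - V n y') < e)"
    if y: "y \<in> S" and e: "0 < e" for y e
  proof -
    obtain d where "d > 0" and d: "\<And>y y' x. y \<in> S \<Longrightarrow> y' \<in> S \<Longrightarrow> x \<in> S \<Longrightarrow> dist y y' < d \<Longrightarrow>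
        \<bar>w x y - w x y'\<bar> < e / 2"
      using continuous_slices_equicontinuous[OF fl.w compact_S compact_S, of "e / 2"] e by auto
    have "norm (V n y - V n y') < e" if "y' \<in> S" "norm (y - y') < d" for n y'
      using modulus[OF y that(1), of "e / 2" n] d[OF y that(1)] that(2) e
      by (force simp: dist_norm)
    with \<open>d > 0\<close> show ?thesis by blast
  qed
  obtain g k where g: "continuous_on S g" "strict_mono (k :: nat \<Rightarrow> nat)"
    and lim: "\<And>e. 0 < e \<Longrightarrow> \<exists>N. \<forall>n x. n \<ge> N \<and> x \<in> S \<longrightarrow> norm (V (k n) x - g x) < e"
    using Arzela_Ascoli[OF compact_S bound equi] by metis
  have "M \<le> J g"
  proof (rule field_le_epsilon)
    fix e :: real assume e: "e > 0"
    obtain N where N: "\<And>n x. n \<ge> N \<Longrightarrow> x \<in> S \<Longrightarrow> norm (V (k n) x - g x) < e / 4"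
      using lim[of "e / 4"] e by auto
    obtain m where m: "inverse (real (Suc m)) < e / 2" using reals_Archimedean[of "e / 2"] e by auto
    let ?n = "max N m"
    have "J (V (k ?n)) \<le> J g + 2 * (e / 4)"
      using N[of ?n] by (intro J_nonexpansive cV g) (force simp: less_imp_le)
    moreover have "inverse (real (Suc (k ?n))) \<le> inverse (real (Suc m))"
      using seq_suble[OF g(2), of ?n] by (intro le_imp_inverse_le) auto
    ultimately show "M \<le> J g + e" using JV[of "k ?n"] m by linarith
  qed
  then show thesis using that[OF g(1)] le_M by (meson order_trans)
qed

text \<open>
  At a maximiser a further Sinkhorn round gains nothing, so it changes the potential only on a null set,
  and then both marginal conditions hold simultaneously.
\<close>

proposition schroedinger_system:
  obtains u v where "continuous_on S u" "continuous_on S v"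
    "\<And>x. x \<in> S \<Longrightarrow> (\<integral>y. exp ((u x + v y - w x y) / \<epsilon>) \<partial>\<nu>) = 1"
    "\<And>y. y \<in> S \<Longrightarrow> (\<integral>x. exp ((u x + v y - w x y) / \<epsilon>) \<partial>\<mu>) = 1"
proof -
  interpret fl: entropic_transport S \<nu> \<mu> "\<lambda>y x. w x y" \<epsilon> by (rule flip)
  obtain v where v: "continuous_on S v" and max: "\<And>v'. continuous_on S v' \<Longrightarrow> J v' \<le> J v"
    by (rule J_maximiser) blast
  note u = continuous_soft_transform[OF v]
  note v2 = fl.continuous_soft_transform[OF u]
  have ae: "AE y in \<nu>. T' (T v) y = v y"
    using J_ascent[OF v] max[OF v2] by (intro integral_soft_transform_gap_nonneg(2)[OF v]) linarith
  show thesis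
  proof (rule that[OF u v2])
    fix x assume x: "x \<in> S"
    have "(\<integral>y. exp ((T v x + T' (T v) y - w x y) / \<epsilon>) \<partial>\<nu>) = (\<integral>y. exp ((T v x + v y - w x y) / \<epsilon>) \<partial>\<nu>)"
      by (rule integral_cong_AE)
        (use ae in \<open>auto intro!: borel_measurable_integrable[OF integrable_kernel[OF v2 x]]
            borel_measurable_integrable[OF integrable_kernel[OF v x]]\<close>)
    then show "(\<integral>y. exp ((T v x + T' (T v) y - w x y) / \<epsilon>) \<partial>\<nu>) = 1"
      by (simp add: soft_transform_normalises[OF v x])
  next
    fix y assume y: "y \<in> S"
    show "(\<integral>x. exp ((T v x + T' (T v) y - w x y) / \<epsilon>) \<partial>\<mu>) = 1"
      using fl.soft_transform_normalises[OF u y] by (simp add: add.commute)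
  qed
qed

end

section \<open>Transport plans and strong duality\<close>

lemma transport_plansD:
  fixes \<mu> \<nu> :: "'a::euclidean_space measure" and f g :: "'a \<Rightarrow> real"
  assumes \<pi>: "\<pi> \<in> transport_plans S \<mu> \<nu>"
    and \<mu>: "\<mu> \<in> prob_measures_on S" and \<nu>: "\<nu> \<in> prob_measures_on S"
  shows "\<pi> \<in> prob_measures_on (S \<times> S)"
    and "continuous_on S f \<Longrightarrow> (\<integral>z. f (fst z) \<partial>\<pi>) = (\<integral>x. f x \<partial>\<mu>)"
    and "continuous_on S g \<Longrightarrow> (\<integral>z. g (snd z) \<partial>\<pi>) = (\<integral>y. g y \<partial>\<nu>)"
proof -
  show \<pi>': "\<pi> \<in> prob_measures_on (S \<times> S)"
    using \<pi> by (simp add: transport_plans_def)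
  have sets: "sets \<pi> = sets (\<mu> \<Otimes>\<^sub>M \<nu>)"
    using \<pi>' sets_pair_prob_measures_on[OF \<mu> \<nu>] by (simp add: prob_measures_on_def)
  have m: "fst \<in> \<pi> \<rightarrow>\<^sub>M \<mu>" "snd \<in> \<pi> \<rightarrow>\<^sub>M \<nu>"
    using measurable_cong_sets[OF sets refl] by (metis measurable_fst, metis measurable_snd)
  show "(\<integral>z. f (fst z) \<partial>\<pi>) = (\<integral>x. f x \<partial>\<mu>)" if "continuous_on S f"
    using integral_distr[OF m(1) measurable_prob_measures_on[OF \<mu> that]] \<pi>
    by (simp add: transport_plans_def)
  show "(\<integral>z. g (snd z) \<partial>\<pi>) = (\<integral>y. g y \<partial>\<nu>)" if "continuous_on S g"
    using integral_distr[OF m(2) measurable_prob_measures_on[OF \<nu> that]] \<pi>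
    by (simp add: transport_plans_def)
qed

lemma density_transport_plan:
  fixes \<mu> \<nu> :: "'a::euclidean_space measure" and d :: "'a \<Rightarrow> 'a \<Rightarrow> real"
  assumes S: "compact S" and \<mu>: "\<mu> \<in> prob_measures_on S" and \<nu>: "\<nu> \<in> prob_measures_on S"
    and d: "continuous_on (S \<times> S) (\<lambda>(x, y). d x y)" and nn: "\<And>x y. d x y \<ge> 0"
    and 1: "\<And>x. x \<in> S \<Longrightarrow> (\<integral>y. d x y \<partial>\<nu>) = 1" and 2: "\<And>y. y \<in> S \<Longrightarrow> (\<integral>x. d x y \<partial>\<mu>) = 1"
  shows "density (\<mu> \<Otimes>\<^sub>M \<nu>) (\<lambda>(x, y). ennreal (d x y)) \<in> transport_plans S \<mu> \<nu>"
    (is "?\<pi> \<in> _")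
proof -
  interpret \<mu>: prob_space \<mu> by (rule prob_space_prob_measures_on) fact
  interpret \<nu>: prob_space \<nu> by (rule prob_space_prob_measures_on) fact
  interpret pair_prob_space \<mu> \<nu> ..
  note sp = space_prob_measures_on[OF \<mu>] space_prob_measures_on[OF \<nu>]
  have "(\<lambda>(x, y). d x y) \<in> borel_measurable (\<mu> \<Otimes>\<^sub>M \<nu>)"
    by (rule measurable_prob_measures_on[OF pair_prob_measures_on[OF \<mu> \<nu>] d])
  from measurable_compose[OF this measurable_ennreal]
  have m[measurable]: "(\<lambda>z. ennreal (d (fst z) (snd z))) \<in> borel_measurable (\<mu> \<Otimes>\<^sub>M \<nu>)"
    by (simp add: case_prod_unfold)
  have dens: "?\<pi> = density (\<mu> \<Otimes>\<^sub>M \<nu>) (\<lambda>z. ennreal (d (fst z) (snd z)))"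
    by (simp add: case_prod_unfold)
  have n1: "(\<integral>\<^sup>+y. ennreal (d x y) \<partial>\<nu>) = 1" if "x \<in> S" for x
    using nn_integral_eq_integral[OF integrable_continuous_prob_measures_on[OF \<nu> S
        continuous_on_slices(1)[OF d that]]] nn 1[OF that] by simp
  have n2: "(\<integral>\<^sup>+x. ennreal (d x y) \<partial>\<mu>) = 1" if "y \<in> S" for y
    using nn_integral_eq_integral[OF integrable_continuous_prob_measures_on[OF \<mu> S
        continuous_on_slices(2)[OF d that]]] nn 2[OF that] by simp
  have e1: "emeasure ?\<pi> (fst -` A \<inter> space ?\<pi>) = emeasure \<mu> A" if A[measurable]: "A \<in> sets \<mu>" for A
  proof -
    have "emeasure ?\<pi> (fst -` A \<inter> space ?\<pi>)
        = (\<integral>\<^sup>+z. ennreal (d (fst z) (snd z)) * indicator (fst -` A \<inter> space (\<mu> \<Otimes>\<^sub>M \<nu>)) z \<partial>(\<mu> \<Otimes>\<^sub>M \<nu>))"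
      unfolding dens by (subst emeasure_density) auto
    also have "\<dots> = (\<integral>\<^sup>+z. ennreal (d (fst z) (snd z)) * indicator A (fst z) \<partial>(\<mu> \<Otimes>\<^sub>M \<nu>))"
      by (rule nn_integral_cong) (auto simp: indicator_def)
    also have "\<dots> = (\<integral>\<^sup>+x. (\<integral>\<^sup>+y. ennreal (d x y) * indicator A x \<partial>\<nu>) \<partial>\<mu>)"
      by (subst \<nu>.nn_integral_fst[symmetric]) auto
    also have "\<dots> = (\<integral>\<^sup>+x. indicator A x \<partial>\<mu>)"
    proof (rule nn_integral_cong)
      fix x assume "x \<in> space \<mu>"
      then have x: "x \<in> S" by (simp add: sp)
      have "(\<lambda>y. ennreal (d x y)) \<in> borel_measurable \<nu>"
        using measurable_prob_measures_on[OF \<nu> continuous_on_slices(1)[OF d x]] by simp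
      then show "(\<integral>\<^sup>+y. ennreal (d x y) * indicator A x \<partial>\<nu>) = indicator A x"
        by (simp add: nn_integral_multc n1[OF x])
    qed
    finally show ?thesis using that by simp
  qed
  have e2: "emeasure ?\<pi> (snd -` A \<inter> space ?\<pi>) = emeasure \<nu> A" if A[measurable]: "A \<in> sets \<nu>" for A
  proof -
    have "emeasure ?\<pi> (snd -` A \<inter> space ?\<pi>)
        = (\<integral>\<^sup>+z. ennreal (d (fst z) (snd z)) * indicator (snd -` A \<inter> space (\<mu> \<Otimes>\<^sub>M \<nu>)) z \<partial>(\<mu> \<Otimes>\<^sub>M \<nu>))"
      unfolding dens by (subst emeasure_density) auto
    also have "\<dots> = (\<integral>\<^sup>+z. ennreal (d (fst z) (snd z)) * indicator A (snd z) \<partial>(\<mu> \<Otimes>\<^sub>M \<nu>))"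
      by (rule nn_integral_cong) (auto simp: indicator_def)
    also have "\<dots> = (\<integral>\<^sup>+y. (\<integral>\<^sup>+x. ennreal (d x y) * indicator A y \<partial>\<mu>) \<partial>\<nu>)"
      by (subst nn_integral_snd[symmetric]) auto
    also have "\<dots> = (\<integral>\<^sup>+y. indicator A y \<partial>\<nu>)"
    proof (rule nn_integral_cong)
      fix y assume "y \<in> space \<nu>"
      then have y: "y \<in> S" by (simp add: sp)
      have "(\<lambda>x. ennreal (d x y)) \<in> borel_measurable \<mu>"
        using measurable_prob_measures_on[OF \<mu> continuous_on_slices(2)[OF d y]] by simp
      then show "(\<integral>\<^sup>+x. ennreal (d x y) * indicator A y \<partial>\<mu>) = indicator A y"
        by (simp add: nn_integral_multc n2[OF y])
    qed
    finally show ?thesis using that by simp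
  qed
  have "fst -` space \<mu> \<inter> space ?\<pi> = space ?\<pi>"
    by (auto simp: space_pair_measure)
  then have "emeasure ?\<pi> (space ?\<pi>) = 1"
    using e1[of "space \<mu>"] by (simp add: \<mu>.emeasure_space_1)
  then have "prob_space ?\<pi>" by (rule prob_spaceI)
  then have "?\<pi> \<in> prob_measures_on (S \<times> S)"
    using sets_pair_prob_measures_on[OF \<mu> \<nu>] by (simp add: prob_measures_on_def)
  moreover have "distr ?\<pi> \<mu> fst = \<mu>"
    by (rule measure_eqI) (simp_all add: emeasure_distr e1[simplified])
  moreover have "distr ?\<pi> \<nu> snd = \<nu>"
    by (rule measure_eqI) (simp_all add: emeasure_distr e2[simplified])
  ultimately show ?thesis by (simp add: transport_plans_def)
qed

context entropic_transport begin

text \<open>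
  On the plan with density \<open>exp l\<close> the cost equals \<open>u x + v y - \<epsilon> * l\<close>. The integral of \<open>l\<close> against the
  plan is a relative entropy, hence nonnegative.
\<close>

lemma entropic_plan:
  assumes u: "continuous_on S u" and v: "continuous_on S v"
    and 1: "\<And>x. x \<in> S \<Longrightarrow> (\<integral>y. exp ((u x + v y - w x y) / \<epsilon>) \<partial>\<nu>) = 1"
    and 2: "\<And>y. y \<in> S \<Longrightarrow> (\<integral>x. exp ((u x + v y - w x y) / \<epsilon>) \<partial>\<mu>) = 1"
  obtains \<pi> where "\<pi> \<in> transport_plans S \<mu> \<nu>"
    "(\<integral>(x, y). w x y \<partial>\<pi>) \<le> (\<integral>x. u x \<partial>\<mu>) + (\<integral>y. v y \<partial>\<nu>)"
proof -
  define l where "l x y = (u x + v y - w x y) / \<epsilon>" for x y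
  let ?\<pi> = "density (\<mu> \<Otimes>\<^sub>M \<nu>) (\<lambda>(x, y). ennreal (exp (l x y)))"
  have pl: "?\<pi> \<in> transport_plans S \<mu> \<nu>"
    unfolding l_def using 1 2
    by (intro density_transport_plan[OF compact_S \<mu> \<nu> continuous_kernel2[OF u v]]) auto
  note \<pi> = transport_plansD[OF pl \<mu> \<nu>]
  interpret \<pi>: prob_space ?\<pi> by (rule prob_space_prob_measures_on[OF \<pi>(1)])
  note int = integrable_continuous_prob_measures_on[OF \<pi>(1) compact_Times[OF compact_S compact_S]]
  have cl: "continuous_on (S \<times> S) (\<lambda>z. l (fst z) (snd z))"
    using \<epsilon> w unfolding l_def case_prod_unfold
    by (intro continuous_intros continuous_on_compose2[OF u] continuous_on_compose2[OF v]) auto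
  have cu: "continuous_on (S \<times> S) (\<lambda>z. u (fst z))" and cv: "continuous_on (S \<times> S) (\<lambda>z. v (snd z))"
    by (auto intro!: continuous_intros continuous_on_compose2[OF u] continuous_on_compose2[OF v])
  \<comment> \<open>The entropy bound comes from \<open>1 - l \<le> exp (- l)\<close>: against the density \<open>exp l\<close> the
    function \<open>exp (- l)\<close> has integral 1.\<close>
  have "(\<integral>z. exp (- l (fst z) (snd z)) \<partial>?\<pi>)
      = (\<integral>z. exp (l (fst z) (snd z)) * exp (- l (fst z) (snd z)) \<partial>(\<mu> \<Otimes>\<^sub>M \<nu>))"
    using measurable_prob_measures_on[OF pair_prob_measures_on[OF \<mu> \<nu>] cl]
    by (simp add: case_prod_unfold integral_density)
  also have "\<dots> = (\<integral>z. 1 \<partial>(\<mu> \<Otimes>\<^sub>M \<nu>))"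
    by (simp add: exp_minus)
  also have "\<dots> = 1"
    using prob_space.prob_space[OF prob_space_prob_measures_on[OF pair_prob_measures_on[OF \<mu> \<nu>]]] by simp
  finally have inv: "(\<integral>z. exp (- l (fst z) (snd z)) \<partial>?\<pi>) = 1" .
  have "(\<integral>z. 1 - l (fst z) (snd z) \<partial>?\<pi>) \<le> (\<integral>z. exp (- l (fst z) (snd z)) \<partial>?\<pi>)"
    by (intro integral_mono int continuous_intros cl)
      (use exp_ge_add_one_self[of "- l x y" for x y] in auto)
  then have ent: "0 \<le> (\<integral>z. l (fst z) (snd z) \<partial>?\<pi>)"
    using inv int[OF cl] \<pi>.prob_space by simp
  have "(\<integral>(x, y). w x y \<partial>?\<pi>) = (\<integral>z. u (fst z) + v (snd z) - \<epsilon> * l (fst z) (snd z) \<partial>?\<pi>)"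
    using \<epsilon> by (intro Bochner_Integration.integral_cong) (auto simp: l_def)
  also have "\<dots> = (\<integral>x. u x \<partial>\<mu>) + (\<integral>y. v y \<partial>\<nu>) - \<epsilon> * (\<integral>z. l (fst z) (snd z) \<partial>?\<pi>)"
    using int[OF cl] int[OF cu] int[OF cv] \<pi>(2)[OF u] \<pi>(3)[OF v] by simp
  also have "\<dots> \<le> (\<integral>x. u x \<partial>\<mu>) + (\<integral>y. v y \<partial>\<nu>)"
    using ent \<epsilon> by simp
  finally show thesis using that[OF pl] by blast
qed

text \<open>
  The exponent \<open>(u x + v y - w x y) / \<epsilon>\<close> cannot be large near a point that carries mass: by the moduli
  of \<open>v\<close> and \<open>w\<close> it would be almost as large on a whole ball around \<open>y\<close>, and the kernel would
  integrate to more than 1. The potential \<open>v\<close> is a transform of \<open>u\<close> and inherits the modulus of \<open>w\<close>,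
  which is why \<open>\<delta>\<close> and \<open>r\<close> can be chosen before \<open>\<epsilon>\<close>.
\<close>

lemma entropic_near_admissible:
  assumes u: "continuous_on S u" and v: "continuous_on S v"
    and 1: "\<And>x. x \<in> S \<Longrightarrow> (\<integral>y. exp ((u x + v y - w x y) / \<epsilon>) \<partial>\<nu>) = 1"
    and 2: "\<And>y. y \<in> S \<Longrightarrow> (\<integral>x. exp ((u x + v y - w x y) / \<epsilon>) \<partial>\<mu>) = 1"
    and \<delta>: "\<And>x y y'. x \<in> S \<Longrightarrow> y \<in> S \<Longrightarrow> y' \<in> S \<Longrightarrow> dist y y' < r \<Longrightarrow> \<bar>w x y - w x y'\<bar> \<le> \<delta>"
    and \<beta>: "0 < \<beta>" "\<beta> \<le> measure \<nu> (ball y r \<inter> S)"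
    and xy: "x \<in> S" "y \<in> S"
  shows "u x + v y - w x y \<le> 2 * \<delta> - \<epsilon> * ln \<beta>"
proof -
  interpret fl: entropic_transport S \<nu> \<mu> "\<lambda>y x. w x y" \<epsilon> by (rule flip)
  have v_eq: "v y = T' u y" if "y \<in> S" for y
    by (rule fl.soft_transform_unique[OF u that]) (use 2[OF that] in \<open>simp add: add.commute\<close>)
  have mod: "\<bar>v y - v y'\<bar> \<le> \<delta>" if "y \<in> S" "y' \<in> S" "dist y y' < r" for y y'
    unfolding v_eq[OF that(1)] v_eq[OF that(2)]
    by (rule fl.soft_transform_modulus[OF u that(1,2)]) (rule \<delta>[OF _ that])
  define s where "s = u x + v y - w x y"
  let ?B = "ball y r \<inter> S"
  have B: "?B \<in> sets \<nu>" by (rule open_Int_in_sets[OF \<nu> open_ball])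
  have "(\<integral>z. indicator ?B z * exp ((s - 2 * \<delta>) / \<epsilon>) \<partial>\<nu>) \<le> (\<integral>z. exp ((u x + v z - w x z) / \<epsilon>) \<partial>\<nu>)"
  proof (rule integral_mono)
    show "integrable \<nu> (\<lambda>z. indicator ?B z * exp ((s - 2 * \<delta>) / \<epsilon>))"
      using B by (intro integrable_mult_left) (simp add: \<nu>.emeasure_eq_measure)
    fix z assume "z \<in> space \<nu>"
    then have z: "z \<in> S" by (simp add: space_\<nu>)
    show "indicator ?B z * exp ((s - 2 * \<delta>) / \<epsilon>) \<le> exp ((u x + v z - w x z) / \<epsilon>)"
    proof (cases "z \<in> ?B")
      case True
      then have "dist y z < r" by simp
      from mod[OF xy(2) z this] \<delta>[OF xy z this]
      have "s - 2 * \<delta> \<le> u x + v z - w x z" unfolding s_def by linarith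
      with True \<epsilon> show ?thesis by (simp add: divide_right_mono)
    qed simp
  qed (rule integrable_kernel[OF v xy(1)])
  then have "measure \<nu> ?B * exp ((s - 2 * \<delta>) / \<epsilon>) \<le> 1"
    using B sets.sets_into_space[OF B] by (simp add: 1[OF xy(1)] Int_absorb2)
  moreover have "\<beta> * exp ((s - 2 * \<delta>) / \<epsilon>) \<le> measure \<nu> ?B * exp ((s - 2 * \<delta>) / \<epsilon>)"
    using \<beta> by (intro mult_right_mono) auto
  ultimately have "\<beta> * exp ((s - 2 * \<delta>) / \<epsilon>) \<le> 1" by linarith
  then have "ln (\<beta> * exp ((s - 2 * \<delta>) / \<epsilon>)) \<le> 0"
    using \<beta> by (subst ln_le_zero_iff) simp_all
  then have "(s - 2 * \<delta>) / \<epsilon> \<le> - ln \<beta>" using \<beta> by (simp add: ln_mult)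
  then have "s - 2 * \<delta> \<le> - ln \<beta> * \<epsilon>" using \<epsilon> by (subst (asm) pos_divide_le_eq) auto
  then show ?thesis unfolding s_def by (simp add: mult.commute)
qed

end

text \<open>
  A finite cover by balls of half the radius gives the bound: almost every point lies in a member of
  the cover with positive measure, and that member is contained in the larger ball around the point.
\<close>

lemma AE_measure_ball_bounded_below:
  fixes \<mu> :: "'a::euclidean_space measure"
  assumes \<mu>: "\<mu> \<in> prob_measures_on S" and S: "compact S" and r: "r > 0"
  obtains \<beta> where "\<beta> > 0" "AE y in \<mu>. \<beta> \<le> measure \<mu> (ball y r \<inter> S)"
proof -
  interpret prob_space \<mu> by (rule prob_space_prob_measures_on) fact
  obtain K where K: "finite K" "S \<subseteq> (\<Union>x\<in>K. ball x (r / 2))"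
    using compactE_image[OF S, of S "\<lambda>x. ball x (r / 2)"] r by (metis UN_I centre_in_ball half_gt_zero open_ball subsetI)
  let ?m = "\<lambda>x. measure \<mu> (ball x (r / 2) \<inter> S)"
  define \<beta> where "\<beta> = Min (insert 1 (?m ` K - {0}))"
  have "\<beta> > 0"
    unfolding \<beta>_def using K(1) by (subst Min_gr_iff) (auto simp: zero_less_measure_iff)
  moreover have "AE y in \<mu>. \<forall>x\<in>K. ?m x = 0 \<longrightarrow> y \<notin> ball x (r / 2) \<inter> S"
    using K(1)
  proof (rule AE_finite_allI)
    fix x
    show "AE y in \<mu>. ?m x = 0 \<longrightarrow> y \<notin> ball x (r / 2) \<inter> S"
    proof (cases "?m x = 0")
      case True
      then have "ball x (r / 2) \<inter> S \<in> null_sets \<mu>"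
        using open_Int_in_sets[OF \<mu> open_ball] by (auto simp: null_sets_def emeasure_eq_measure)
      then show ?thesis by (auto dest: AE_not_in)
    qed simp
  qed
  then have "AE y in \<mu>. \<beta> \<le> measure \<mu> (ball y r \<inter> S)"
  proof (rule AE_mp, intro AE_I2 impI)
    fix y assume y: "y \<in> space \<mu>" and *: "\<forall>x\<in>K. ?m x = 0 \<longrightarrow> y \<notin> ball x (r / 2) \<inter> S"
    obtain x where x: "x \<in> K" "y \<in> ball x (r / 2)"
      using K(2) y by (auto simp: space_prob_measures_on[OF \<mu>])
    have "?m x \<in> ?m ` K - {0}"
      using * x y by (auto simp: space_prob_measures_on[OF \<mu>])
    then have "\<beta> \<le> ?m x" unfolding \<beta>_def using K(1) by (intro Min_le) auto
    also have "\<dots> \<le> measure \<mu> (ball y r \<inter> S)"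
    proof (intro finite_measure_mono open_Int_in_sets[OF \<mu> open_ball] Int_mono order_refl subsetI)
      fix z assume "z \<in> ball x (r / 2)"
      then show "z \<in> ball y r" using x(2) dist_triangle_half_r[of x y r z] by simp
    qed
    finally show "\<beta> \<le> measure \<mu> (ball y r \<inter> S)" .
  qed
  ultimately show thesis using that by blast
qed

definition c_transform :: "'a set \<Rightarrow> ('a \<Rightarrow> 'a \<Rightarrow> real) \<Rightarrow> ('a \<Rightarrow> real) \<Rightarrow> 'a \<Rightarrow> real" where
  "c_transform S w v x = (INF y\<in>S. w x y - v y)"

lemma c_transform:
  fixes S :: "'a::metric_space set"
  assumes S: "compact S" "S \<noteq> {}" and w: "continuous_on (S \<times> S) (\<lambda>(x, y). w x y)"
    and v: "continuous_on S v"
  shows c_transform_le: "\<And>x y. x \<in> S \<Longrightarrow> y \<in> S \<Longrightarrow> c_transform S w v x + v y \<le> w x y"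
    and c_transform_attained: "\<And>x. x \<in> S \<Longrightarrow> \<exists>y\<in>S. c_transform S w v x + v y = w x y"
    and continuous_c_transform: "continuous_on S (c_transform S w v)"
proof -
  have *: "\<exists>y\<in>S. c_transform S w v x = w x y - v y \<and> (\<forall>y'\<in>S. c_transform S w v x \<le> w x y' - v y')"
    if x: "x \<in> S" for x
  proof -
    have "continuous_on S (\<lambda>y. w x y - v y)"
      by (intro continuous_intros continuous_on_slices(1)[OF w x] v)
    then obtain y where y: "y \<in> S" "\<And>y'. y' \<in> S \<Longrightarrow> w x y - v y \<le> w x y' - v y'"
      using continuous_attains_inf[OF S, of "\<lambda>y. w x y - v y"] by blast
    have "c_transform S w v x = w x y - v y"
      unfolding c_transform_def by (rule cInf_eq_minimum) (use y in auto)
    with y show ?thesis by auto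
  qed
  show le: "c_transform S w v x + v y \<le> w x y" if "x \<in> S" "y \<in> S" for x y
    using * that by (fastforce simp: algebra_simps)
  show att: "\<exists>y\<in>S. c_transform S w v x + v y = w x y" if "x \<in> S" for x
    using * that by (fastforce simp: algebra_simps)
  show "continuous_on S (c_transform S w v)"
    unfolding continuous_on_iff
  proof (intro ballI allI impI)
    fix x and e :: real assume x: "x \<in> S" "e > 0"
    obtain d where "d > 0" and d: "\<And>x x' y. x \<in> S \<Longrightarrow> x' \<in> S \<Longrightarrow> y \<in> S \<Longrightarrow> dist x x' < d \<Longrightarrow>
        \<bar>w x y - w x' y\<bar> < e"
      using continuous_slices_equicontinuous[OF w S(1) S(1) x(2)] by blast
    have one_sided: "c_transform S w v x1 < c_transform S w v x2 + e"
      if x12: "x1 \<in> S" "x2 \<in> S" "dist x1 x2 < d" for x1 x2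
    proof -
      obtain y where y: "y \<in> S" "c_transform S w v x2 + v y = w x2 y"
        using att[OF x12(2)] by blast
      with le[OF x12(1) y(1)] d[OF x12(1,2) y(1) x12(3)] show ?thesis by linarith
    qed
    have "dist (c_transform S w v x') (c_transform S w v x) < e" if "x' \<in> S" "dist x' x < d" for x'
      using one_sided[OF that(1) x(1) that(2)] one_sided[OF x(1) that(1)] that(2)
      by (simp add: dist_real_def dist_commute abs_less_iff)
    then show "\<exists>d>0. \<forall>x'\<in>S. dist x' x < d \<longrightarrow> dist (c_transform S w v x') (c_transform S w v x) < e"
      using \<open>d > 0\<close> by blast
  qed
qed

text \<open>
  The absence of a duality gap. The bound on admissible pairs is tested on the entropic potential \<open>u\<close> and
  its \<open>c\<close>-transform. This pair is admissible on all of \<open>S \<times> S\<close>, and almost everywhere for \<open>\<nu>\<close> the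
  transform lies at most \<open>\<kappa>\<close> below the entropic potential \<open>v\<close>. The entropic plan of \<open>u\<close> and \<open>v\<close> then costs at most \<open>D + \<kappa>\<close>.
\<close>

proposition approximate_duality:
  fixes \<mu> \<nu> :: "'a::euclidean_space measure" and w :: "'a \<Rightarrow> 'a \<Rightarrow> real"
  assumes S: "compact S" and \<mu>: "\<mu> \<in> prob_measures_on S" and \<nu>: "\<nu> \<in> prob_measures_on S"
    and w: "continuous_on (S \<times> S) (\<lambda>(x, y). w x y)"
    and dual: "\<And>u v. continuous_on S u \<Longrightarrow> continuous_on S v \<Longrightarrow>
        (\<And>x y. x \<in> S \<Longrightarrow> y \<in> S \<Longrightarrow> u x + v y \<le> w x y) \<Longrightarrow> (\<integral>x. u x \<partial>\<mu>) + (\<integral>y. v y \<partial>\<nu>) \<le> D"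
    and \<kappa>: "\<kappa> > 0"
  obtains \<pi> where "\<pi> \<in> transport_plans S \<mu> \<nu>" "(\<integral>(x, y). w x y \<partial>\<pi>) \<le> D + \<kappa>"
proof -
  have S0: "S \<noteq> {}" by (rule nonempty_prob_measures_on[OF \<mu>])
  note w' = continuous_on_slices(3)[OF w]
  interpret \<nu>: prob_space \<nu> by (rule prob_space_prob_measures_on[OF \<nu>])
  obtain r where r: "r > 0" and mod: "\<And>y y' x. y \<in> S \<Longrightarrow> y' \<in> S \<Longrightarrow> x \<in> S \<Longrightarrow> dist y y' < r \<Longrightarrow>
      \<bar>w x y - w x y'\<bar> < \<kappa> / 4"
    using continuous_slices_equicontinuous[OF w' S S, of "\<kappa> / 4"] \<kappa> by auto
  obtain \<beta> where \<beta>: "\<beta> > 0" "AE y in \<nu>. \<beta> \<le> measure \<nu> (ball y r \<inter> S)"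
    by (rule AE_measure_ball_bounded_below[OF \<nu> S r])
  \<comment> \<open>The error in near-admissibility is twice \<open>\<kappa> / 4\<close> from the modulus plus \<open>- \<epsilon> * ln \<beta>\<close>.
    The radius and hence \<open>\<beta>\<close> depend on \<open>\<kappa>\<close> only, so \<open>\<epsilon>\<close> can be chosen last.\<close>
  define \<epsilon> where "\<epsilon> = \<kappa> / (2 * (1 + \<bar>ln \<beta>\<bar>))"
  have \<epsilon>: "\<epsilon> > 0" using \<kappa> by (auto simp: \<epsilon>_def)
  have "\<epsilon> * (1 + \<bar>ln \<beta>\<bar>) = \<kappa> / 2"
    unfolding \<epsilon>_def by (simp add: divide_simps)
  moreover have "- \<epsilon> * ln \<beta> \<le> \<epsilon> * (1 + \<bar>ln \<beta>\<bar>)"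
  proof -
    have "\<epsilon> * (- ln \<beta>) \<le> \<epsilon> * (1 + \<bar>ln \<beta>\<bar>)" using \<epsilon> by (intro mult_left_mono) auto
    then show ?thesis by simp
  qed
  ultimately have \<epsilon>\<beta>: "- \<epsilon> * ln \<beta> \<le> \<kappa> / 2" by linarith
  interpret entropic_transport S \<mu> \<nu> w \<epsilon>
    using S \<mu> \<nu> w \<epsilon> by unfold_locales
  obtain u v where u: "continuous_on S u" and v: "continuous_on S v"
    and 1: "\<And>x. x \<in> S \<Longrightarrow> (\<integral>y. exp ((u x + v y - w x y) / \<epsilon>) \<partial>\<nu>) = 1"
    and 2: "\<And>y. y \<in> S \<Longrightarrow> (\<integral>x. exp ((u x + v y - w x y) / \<epsilon>) \<partial>\<mu>) = 1"
    by (rule schroedinger_system) blast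
  define v' where "v' = c_transform S (\<lambda>y x. w x y) u"
  have v': "continuous_on S v'" unfolding v'_def by (rule continuous_c_transform[OF S S0 w' u])
  have "AE y in \<nu>. v y - \<kappa> \<le> v' y"
    using \<beta>(2)
  proof (rule AE_mp, intro AE_I2 impI)
    fix y assume "y \<in> space \<nu>" and b: "\<beta> \<le> measure \<nu> (ball y r \<inter> S)"
    then have y: "y \<in> S" by (simp add: space_\<nu>)
    obtain x where x: "x \<in> S" "v' y + u x = w x y"
      unfolding v'_def using c_transform_attained[OF S S0 w' u y] by blast
    have "u x + v y - w x y \<le> 2 * (\<kappa> / 4) - \<epsilon> * ln \<beta>"
      by (rule entropic_near_admissible[OF u v 1 2 _ \<beta>(1) b x(1) y]) (use mod in \<open>auto simp: less_imp_le\<close>)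
    then show "v y - \<kappa> \<le> v' y" using x(2) \<epsilon>\<beta> by simp
  qed
  then have "(\<integral>y. v y - \<kappa> \<partial>\<nu>) \<le> (\<integral>y. v' y \<partial>\<nu>)"
    by (intro integral_mono_AE integrable_\<nu> continuous_intros v v')
  then have "(\<integral>y. v y \<partial>\<nu>) - \<kappa> \<le> (\<integral>y. v' y \<partial>\<nu>)"
    using integrable_\<nu>[OF v] by (simp add: \<nu>.prob_space)
  moreover have "(\<integral>x. u x \<partial>\<mu>) + (\<integral>y. v' y \<partial>\<nu>) \<le> D"
  proof (rule dual[OF u v'])
    fix x y assume "x \<in> S" "y \<in> S"
    then show "u x + v' y \<le> w x y"
      using c_transform_le[OF S S0 w' u] unfolding v'_def by (metis add.commute)
  qed
  moreover obtain \<pi> where "\<pi> \<in> transport_plans S \<mu> \<nu>"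
    "(\<integral>(x, y). w x y \<partial>\<pi>) \<le> (\<integral>x. u x \<partial>\<mu>) + (\<integral>y. v y \<partial>\<nu>)"
    by (rule entropic_plan[OF u v 1 2])
  ultimately show thesis using that by fastforce
qed

section \<open>Kantorovich potentials\<close>

lemma kantorovich_potentialsD:
  assumes "(\<phi>, \<psi>) \<in> kantorovich_potentials S c \<mu> \<nu>"
  shows "continuous_on S \<phi>" "continuous_on S \<psi>"
    and "\<And>x y. x \<in> S \<Longrightarrow> y \<in> S \<Longrightarrow> \<phi> x + \<psi> y \<le> c (x, y)"
    and "\<And>u v. continuous_on S u \<Longrightarrow> continuous_on S v \<Longrightarrow>
      (\<And>x y. x \<in> S \<Longrightarrow> y \<in> S \<Longrightarrow> u x + v y \<le> c (x, y)) \<Longrightarrow>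
      (\<integral>x. u x \<partial>\<mu>) + (\<integral>y. v y \<partial>\<nu>) \<le> (\<integral>x. \<phi> x \<partial>\<mu>) + (\<integral>y. \<psi> y \<partial>\<nu>)"
  using assms by (auto simp: kantorovich_potentials_def dual_admissible_def)

text \<open>
  With no duality gap, the nonnegative continuous slack \<open>c - \<phi> - \<psi>\<close> has integral 0 against every optimal
  plan, so it vanishes on the support of the plan.
\<close>

lemma complementary_slackness:
  fixes \<mu> \<nu> :: "'a::euclidean_space measure"
  assumes S: "compact S" and \<mu>: "\<mu> \<in> prob_measures_on S" and \<nu>: "\<nu> \<in> prob_measures_on S"
    and c: "continuous_on (S \<times> S) c"
    and pot: "(\<phi>, \<psi>) \<in> kantorovich_potentials S c \<mu> \<nu>"
    and \<pi>: "\<pi> \<in> optimal_plans S c \<mu> \<nu>" and xy: "(x, y) \<in> supp \<pi>"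
  shows "\<phi> x + \<psi> y = c (x, y)"
proof -
  note \<phi> = kantorovich_potentialsD(1)[OF pot] and \<psi> = kantorovich_potentialsD(2)[OF pot]
  define D where "D = (\<integral>x. \<phi> x \<partial>\<mu>) + (\<integral>y. \<psi> y \<partial>\<nu>)"
  let ?f = "\<lambda>z. c z - \<phi> (fst z) - \<psi> (snd z)"
  have cf: "continuous_on (S \<times> S) ?f"
    by (auto intro!: continuous_intros c continuous_on_compose2[OF \<phi>] continuous_on_compose2[OF \<psi>])
  have cw: "continuous_on (S \<times> S) (\<lambda>(x, y). c (x, y))" using c by simp
  have nn: "?f z \<ge> 0" if "z \<in> S \<times> S" for z
    using kantorovich_potentialsD(3)[OF pot, of "fst z" "snd z"] that by auto
  have int: "integrable \<pi>' ?f" "(\<integral>z. c z \<partial>\<pi>') = D + (\<integral>z. ?f z \<partial>\<pi>')" "0 \<le> (\<integral>z. ?f z \<partial>\<pi>')"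
    if "\<pi>' \<in> transport_plans S \<mu> \<nu>" for \<pi>'
  proof -
    note \<pi>' = transport_plansD[OF that \<mu> \<nu>]
    note int = integrable_continuous_prob_measures_on[OF \<pi>'(1) compact_Times[OF S S]]
    show "integrable \<pi>' ?f" by (rule int[OF cf])
    have "integrable \<pi>' (\<lambda>z. \<phi> (fst z))" "integrable \<pi>' (\<lambda>z. \<psi> (snd z))" "integrable \<pi>' c"
      by (auto intro!: int c continuous_intros continuous_on_compose2[OF \<phi>] continuous_on_compose2[OF \<psi>])
    then show "(\<integral>z. c z \<partial>\<pi>') = D + (\<integral>z. ?f z \<partial>\<pi>')"
      using \<pi>'(2)[OF \<phi>] \<pi>'(3)[OF \<psi>] by (simp add: D_def)
    show "0 \<le> (\<integral>z. ?f z \<partial>\<pi>')"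
      by (rule Bochner_Integration.integral_nonneg) (use nn space_prob_measures_on[OF \<pi>'(1)] in auto)
  qed
  have \<pi>1: "\<pi> \<in> transport_plans S \<mu> \<nu>" and \<pi>2: "(\<integral>z. c z \<partial>\<pi>) = transport_cost S c \<mu> \<nu>"
    using \<pi> by (auto simp: optimal_plans_def)
  have "transport_cost S c \<mu> \<nu> \<le> D"
  proof (rule field_le_epsilon)
    fix \<kappa> :: real assume \<kappa>: "\<kappa> > 0"
    obtain \<pi>' where \<pi>': "\<pi>' \<in> transport_plans S \<mu> \<nu>" "(\<integral>(x, y). c (x, y) \<partial>\<pi>') \<le> D + \<kappa>"
      by (rule approximate_duality[OF S \<mu> \<nu> cw kantorovich_potentialsD(4)[OF pot, folded D_def] \<kappa>]) auto
    have "transport_cost S c \<mu> \<nu> \<le> (\<integral>z. c z \<partial>\<pi>')"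
      unfolding transport_cost_def
    proof (rule cINF_lower[OF _ \<pi>'(1)])
      show "bdd_below ((\<lambda>\<pi>'. \<integral>z. c z \<partial>\<pi>') ` transport_plans S \<mu> \<nu>)"
        using int(2,3) by (intro bdd_belowI2[where m = D]) simp
    qed
    with \<pi>'(2) show "transport_cost S c \<mu> \<nu> \<le> D + \<kappa>" by simp
  qed
  then have "(\<integral>z. ?f z \<partial>\<pi>) = 0" using int(2,3)[OF \<pi>1] \<pi>2 by linarith
  moreover have "AE z in \<pi>. 0 \<le> ?f z"
    using nn space_prob_measures_on[OF transport_plansD(1)[OF \<pi>1 \<mu> \<nu>]] by (intro AE_I2) simp
  ultimately have "AE z in \<pi>. ?f z = 0"
    using integral_nonneg_eq_0_iff_AE[OF int(1)[OF \<pi>1]] by blast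
  from AE_zero_imp_zero_on_supp[OF transport_plansD(1)[OF \<pi>1 \<mu> \<nu>] cf this xy]
  show ?thesis by simp
qed

text \<open>
  Replacing \<open>\<phi>\<close> by the \<open>c\<close>-transform of \<open>\<psi>\<close> keeps the pair admissible and can only increase \<open>\<phi>\<close>.
  Maximality makes the two agree almost everywhere, hence on the support, and the infimum that defines the
  transform is attained on the compact set.
\<close>

lemma contact_point_exists:
  fixes \<mu> \<nu> :: "'a::euclidean_space measure"
  assumes S: "compact S" and \<mu>: "\<mu> \<in> prob_measures_on S"
    and c: "continuous_on (S \<times> S) c"
    and pot: "(\<phi>, \<psi>) \<in> kantorovich_potentials S c \<mu> \<nu>" and x: "x \<in> supp \<mu>"
  shows "\<exists>y\<in>S. \<phi> x + \<psi> y = c (x, y)"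
proof -
  note \<phi> = kantorovich_potentialsD(1)[OF pot] and \<psi> = kantorovich_potentialsD(2)[OF pot]
  have cw: "continuous_on (S \<times> S) (\<lambda>(x, y). c (x, y))" using c by simp
  define \<phi>' where "\<phi>' = c_transform S (\<lambda>x y. c (x, y)) \<psi>"
  note ht = c_transform[OF S nonempty_prob_measures_on[OF \<mu>] cw \<psi>, folded \<phi>'_def]
  have xS: "x \<in> S" using x by (simp add: supp_def space_prob_measures_on[OF \<mu>])
  have le: "\<phi> x \<le> \<phi>' x" if "x \<in> S" for x
    using ht(2)[OF that] kantorovich_potentialsD(3)[OF pot that] by force
  note int = integrable_continuous_prob_measures_on[OF \<mu> S]
  have "(\<integral>x. \<phi>' x \<partial>\<mu>) \<le> (\<integral>x. \<phi> x \<partial>\<mu>)"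
    using kantorovich_potentialsD(4)[OF pot ht(3) \<psi> ht(1)] by simp
  moreover have "0 \<le> (\<integral>x. \<phi>' x - \<phi> x \<partial>\<mu>)"
    by (rule Bochner_Integration.integral_nonneg) (use le space_prob_measures_on[OF \<mu>] in auto)
  ultimately have "(\<integral>x. \<phi>' x - \<phi> x \<partial>\<mu>) = 0"
    using int[OF \<phi>] int[OF ht(3)] by simp
  then have "AE x in \<mu>. \<phi>' x - \<phi> x = 0"
    using integral_nonneg_eq_0_iff_AE[OF Bochner_Integration.integrable_diff[OF int[OF ht(3)] int[OF \<phi>]]]
      le space_prob_measures_on[OF \<mu>] by auto
  from AE_zero_imp_zero_on_supp[OF \<mu> continuous_on_diff[OF ht(3) \<phi>] this x]
  have "\<phi>' x = \<phi> x" by simp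
  then show ?thesis using ht(2)[OF xS] by simp
qed

text \<open>
  Applied to the average, \<open>contact_point_exists\<close> yields a point of contact that both pairs share: the
  average of two inequalities is an equality only if both are.
\<close>

lemma average_kantorovich_potentials:
  fixes \<mu> \<nu> :: "'a::euclidean_space measure"
  assumes S: "compact S" and \<mu>: "\<mu> \<in> prob_measures_on S" and \<nu>: "\<nu> \<in> prob_measures_on S"
    and 1: "(\<phi>1, \<psi>1) \<in> kantorovich_potentials S c \<mu> \<nu>"
    and 2: "(\<phi>2, \<psi>2) \<in> kantorovich_potentials S c \<mu> \<nu>"
  shows "(\<lambda>x. (\<phi>1 x + \<phi>2 x) / 2, \<lambda>y. (\<psi>1 y + \<psi>2 y) / 2) \<in> kantorovich_potentials S c \<mu> \<nu>"
proof -
  note D1 = kantorovich_potentialsD[OF 1] and D2 = kantorovich_potentialsD[OF 2]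
  have adm: "(\<lambda>x. (\<phi>1 x + \<phi>2 x) / 2, \<lambda>y. (\<psi>1 y + \<psi>2 y) / 2) \<in> dual_admissible S c"
  proof -
    have "(\<phi>1 x + \<phi>2 x) / 2 + (\<psi>1 y + \<psi>2 y) / 2 \<le> c (x, y)" if "x \<in> S" "y \<in> S" for x y
      using D1(3)[OF that] D2(3)[OF that] by (simp add: field_simps)
    then show ?thesis
      by (auto simp: dual_admissible_def intro!: continuous_intros D1 D2)
  qed
  have eq: "(\<integral>x. (\<phi>1 x + \<phi>2 x) / 2 \<partial>\<mu>) + (\<integral>y. (\<psi>1 y + \<psi>2 y) / 2 \<partial>\<nu>)
      = (((\<integral>x. \<phi>1 x \<partial>\<mu>) + (\<integral>y. \<psi>1 y \<partial>\<nu>)) + ((\<integral>x. \<phi>2 x \<partial>\<mu>) + (\<integral>y. \<psi>2 y \<partial>\<nu>))) / 2"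
    using integrable_continuous_prob_measures_on[OF \<mu> S D1(1)] integrable_continuous_prob_measures_on[OF \<mu> S D2(1)]
      integrable_continuous_prob_measures_on[OF \<nu> S D1(2)] integrable_continuous_prob_measures_on[OF \<nu> S D2(2)]
    by (simp add: field_simps)
  have "(\<integral>x. u x \<partial>\<mu>) + (\<integral>y. v y \<partial>\<nu>)
      \<le> (\<integral>x. (\<phi>1 x + \<phi>2 x) / 2 \<partial>\<mu>) + (\<integral>y. (\<psi>1 y + \<psi>2 y) / 2 \<partial>\<nu>)"
    if "(u, v) \<in> dual_admissible S c" for u v
  proof -
    have uv: "continuous_on S u" "continuous_on S v" "\<And>x y. x \<in> S \<Longrightarrow> y \<in> S \<Longrightarrow> u x + v y \<le> c (x, y)"
      using that by (auto simp: dual_admissible_def)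
    show ?thesis unfolding eq using D1(4)[OF uv] D2(4)[OF uv] by (simp add: field_simps)
  qed
  with adm show ?thesis by (auto simp: kantorovich_potentials_def)
qed

section \<open>Common first-order information along segments\<close>

text \<open>
  Two functions with a common supergradient \<open>p\<close> at every point, with an error that is uniform in the
  point, have the same increment. On a grid of mesh \<open>q\<close>, both increments over a cell lie between
  \<open>q * p\<close> at its right end and \<open>q * p\<close> at its left end up to small errors. Their difference is therefore at most the decrease
  of \<open>q * p\<close> over the cell, and these decreases telescope to \<open>q * (p 0 - p 1)\<close>, which is
  arbitrarily small.
\<close>

lemma common_superderivative_imp_equal_increment:
  fixes g1 g2 p :: "real \<Rightarrow> real"
  assumes super: "\<And>e. e > 0 \<Longrightarrow> \<exists>d>0. \<forall>s\<in>{0..1}. \<forall>t\<in>{0..1}. \<bar>s - t\<bar> < d \<longrightarrow>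
      g1 s - g1 t \<le> (s - t) * p t + e * \<bar>s - t\<bar> \<and> g2 s - g2 t \<le> (s - t) * p t + e * \<bar>s - t\<bar>"
  shows "g1 1 - g1 0 = g2 1 - g2 0"
proof -
  have "\<bar>(g1 1 - g1 0) - (g2 1 - g2 0)\<bar> \<le> 0 + e" if "e > 0" for e
  proof -
    have e: "e / 3 > 0" using that by simp
    obtain d where d: "d > 0" and
      1: "\<And>s t. s \<in> {0..1} \<Longrightarrow> t \<in> {0..1} \<Longrightarrow> \<bar>s - t\<bar> < d \<Longrightarrow> g1 s - g1 t \<le> (s - t) * p t + e / 3 * \<bar>s - t\<bar>" and
      2: "\<And>s t. s \<in> {0..1} \<Longrightarrow> t \<in> {0..1} \<Longrightarrow> \<bar>s - t\<bar> < d \<Longrightarrow> g2 s - g2 t \<le> (s - t) * p t + e / 3 * \<bar>s - t\<bar>"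
      using super[OF e] by metis
    obtain N :: nat where N: "max (1 / d) (\<bar>p 0 - p 1\<bar> / (e / 3)) < real N"
      using reals_Archimedean2 by blast
    define q where "q = 1 / real N"
    have N0: "0 < real N" using N d by (meson less_trans max_less_iff_conj zero_less_divide_1_iff)
    have q: "q > 0" "q < d" "\<bar>p 0 - p 1\<bar> * q < e / 3"
      using N N0 d e by (auto simp: q_def field_simps)
    define t where "t j = real j * q" for j :: nat
    have tN: "t N = 1" "t 0 = 0" using N0 by (auto simp: t_def q_def)
    have tin: "t j \<in> {0..1}" if "j \<le> N" for j
      using that N0 by (auto simp: t_def q_def field_simps)
    have ts: "t (Suc j) - t j = q" for j by (simp add: t_def algebra_simps)
    let ?F = "\<lambda>j. g1 (t j) - g2 (t j)"
    have step: "\<bar>?F (Suc j) - ?F j\<bar> \<le> (p (t j) - p (t (Suc j))) * q + 2 * (e / 3) * q" if "j < N" for j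
    proof -
      have in01: "t (Suc j) \<in> {0..1}" "t j \<in> {0..1}" using that by (auto intro!: tin simp del: atLeastAtMost_iff)
      have abs: "\<bar>t (Suc j) - t j\<bar> = q" "\<bar>t j - t (Suc j)\<bar> = q" "t j - t (Suc j) = - q"
        using ts[of j] q by auto
      have "g1 (t (Suc j)) - g1 (t j) \<le> q * p (t j) + e / 3 * q"
        "g2 (t (Suc j)) - g2 (t j) \<le> q * p (t j) + e / 3 * q"
        using 1[OF in01] 2[OF in01] q unfolding abs ts by auto
      moreover have "g1 (t j) - g1 (t (Suc j)) \<le> - q * p (t (Suc j)) + e / 3 * q"
        "g2 (t j) - g2 (t (Suc j)) \<le> - q * p (t (Suc j)) + e / 3 * q"
        using 1[OF in01(2,1)] 2[OF in01(2,1)] q unfolding abs by auto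
      ultimately show ?thesis by (simp add: algebra_simps abs_le_iff)
    qed
    have "\<bar>?F N - ?F 0\<bar> = \<bar>\<Sum>j<N. ?F (Suc j) - ?F j\<bar>"
      by (subst sum_lessThan_telescope) simp
    also have "\<dots> \<le> (\<Sum>j<N. \<bar>?F (Suc j) - ?F j\<bar>)" by (rule sum_abs)
    also have "\<dots> \<le> (\<Sum>j<N. (p (t j) - p (t (Suc j))) * q + 2 * (e / 3) * q)"
      by (intro sum_mono step) simp
    also have "\<dots> = (\<Sum>j<N. p (t j) - p (t (Suc j))) * q + real N * (2 * (e / 3) * q)"
      by (simp add: sum.distrib sum_distrib_right)
    also have "(\<Sum>j<N. p (t j) - p (t (Suc j))) = p 0 - p 1"
      using sum_lessThan_telescope'[of "\<lambda>j. p (t j)" N] tN by simp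
    also have "real N * (2 * (e / 3) * q) = 2 * (e / 3)" using N0 by (simp add: q_def)
    also have "(p 0 - p 1) * q \<le> \<bar>p 0 - p 1\<bar> * q" using q by (intro mult_right_mono) auto
    finally show ?thesis using q(3) tN by (simp add: algebra_simps)
  qed
  then have "\<bar>(g1 1 - g1 0) - (g2 1 - g2 0)\<bar> \<le> 0" by (rule field_le_epsilon)
  then show ?thesis by simp
qed

lemma C1_on_imp_continuous_on: "C1_on f S \<Longrightarrow> continuous_on S f"
  unfolding C1_on_def by (auto intro: has_derivative_continuous_on)

text \<open>
  At a point \<open>x\<close> touching \<open>y\<close>, each potential satisfies \<open>\<phi> x' - \<phi> x \<le> c (x', y) - c (x, y)\<close>. A common \<open>y\<close>
  makes the directional derivative of \<open>c\<close> at \<open>(x, y)\<close> a supergradient for both, and uniform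
  continuity of the derivative on the compact product makes the error uniform.
\<close>

lemma common_contact_imp_equal_increment:
  fixes c :: "'a::euclidean_space \<times> 'a \<Rightarrow> real"
  assumes S: "compact S" and c: "C1_on c (S \<times> S)"
    and le1: "\<And>x y. x \<in> S \<Longrightarrow> y \<in> S \<Longrightarrow> \<phi>1 x + \<psi>1 y \<le> c (x, y)"
    and le2: "\<And>x y. x \<in> S \<Longrightarrow> y \<in> S \<Longrightarrow> \<phi>2 x + \<psi>2 y \<le> c (x, y)"
    and seg: "closed_segment a b \<subseteq> S"
    and contact: "\<And>x. x \<in> closed_segment a b \<Longrightarrow>
      \<exists>y\<in>S. \<phi>1 x + \<psi>1 y = c (x, y) \<and> \<phi>2 x + \<psi>2 y = c (x, y)"
  shows "\<phi>1 b - \<phi>1 a = \<phi>2 b - \<phi>2 a"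
proof -
  obtain D :: "'a \<times> 'a \<Rightarrow> ('a \<times> 'a) \<Rightarrow>\<^sub>L real"
    where D: "\<And>z. z \<in> S \<times> S \<Longrightarrow> (c has_derivative blinfun_apply (D z)) (at z within S \<times> S)"
      and cD: "continuous_on (S \<times> S) D"
    using c unfolding C1_on_def by blast
  define h where "h = b - a"
  define \<gamma> where "\<gamma> t = a + t *\<^sub>R h" for t
  have \<gamma>_seg: "\<gamma> t \<in> closed_segment a b" if "t \<in> {0..1}" for t
    using that by (auto simp: \<gamma>_def h_def in_segment algebra_simps intro!: exI[of _ t])
  have \<gamma>S: "\<gamma> t \<in> S" if "t \<in> {0..1}" for t using \<gamma>_seg[OF that] seg by blast
  obtain Y where Y: "\<And>t. t \<in> {0..1} \<Longrightarrow> Y t \<in> S" and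
    Y1: "\<And>t. t \<in> {0..1} \<Longrightarrow> \<phi>1 (\<gamma> t) + \<psi>1 (Y t) = c (\<gamma> t, Y t)" and
    Y2: "\<And>t. t \<in> {0..1} \<Longrightarrow> \<phi>2 (\<gamma> t) + \<psi>2 (Y t) = c (\<gamma> t, Y t)"
    using contact[OF \<gamma>_seg] by metis
  define p where "p t = blinfun_apply (D (\<gamma> t, Y t)) (h, 0)" for t
  have "\<phi>1 (\<gamma> 1) - \<phi>1 (\<gamma> 0) = \<phi>2 (\<gamma> 1) - \<phi>2 (\<gamma> 0)"
  proof (rule common_superderivative_imp_equal_increment[where p = p])
    fix e :: real assume e: "e > 0"
    define e' where "e' = e / (norm h + 1)"
    have e': "e' > 0" using e by (auto simp: e'_def add_nonneg_pos)
    have "uniformly_continuous_on (S \<times> S) D"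
      by (intro compact_uniformly_continuous cD compact_Times S)
    from this[unfolded uniformly_continuous_on_def, rule_format, OF e']
    obtain d' where d': "d' > 0" and
      close: "\<And>z z'. z \<in> S \<times> S \<Longrightarrow> z' \<in> S \<times> S \<Longrightarrow> dist z' z < d' \<Longrightarrow> norm (D z' - D z) < e'"
      by (metis dist_norm)
    have h0: "0 < norm h + 1" by (simp add: add_nonneg_pos)
    define d where "d = d' / (norm h + 1)"
    have d: "d > 0" using d' h0 by (simp add: d_def)
    have expansion: "c (\<gamma> s, Y t) - c (\<gamma> t, Y t) \<le> (s - t) * p t + e * \<bar>s - t\<bar>"
      if s: "s \<in> {0..1}" and t: "t \<in> {0..1}" and st: "\<bar>s - t\<bar> < d" for s t
    proof -
      \<comment> \<open>A piece of the path that contains the segment from \<open>(\<gamma> t, Y t)\<close> to \<open>(\<gamma> s, Y t)\<close> and on which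
        the derivative of \<open>c\<close> stays within \<open>e'\<close> of its value at \<open>(\<gamma> t, Y t)\<close>.\<close>
      define Q where "Q = (\<lambda>r. (\<gamma> r, Y t)) ` {r \<in> {0..1}. \<bar>r - t\<bar> \<le> \<bar>s - t\<bar>}"
      have Q: "Q \<subseteq> S \<times> S" unfolding Q_def using \<gamma>S Y[OF t] by auto
      have zQ: "(\<gamma> t, Y t) \<in> Q" unfolding Q_def using t by auto
      have diff: "(\<gamma> s, Y t) - (\<gamma> t, Y t) = (s - t) *\<^sub>R (h, 0)"
        by (simp add: \<gamma>_def algebra_simps)
      have "norm (c (\<gamma> s, Y t) - c (\<gamma> t, Y t) - blinfun_apply (D (\<gamma> t, Y t)) ((\<gamma> s, Y t) - (\<gamma> t, Y t)))
          \<le> norm ((\<gamma> s, Y t) - (\<gamma> t, Y t)) * e'"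
      proof (rule differentiable_bound_linearization[where S = Q])
        fix r :: real assume r: "r \<in> {0..1}"
        have "t + r * (s - t) \<in> {0..1}"
          using convexD_alt[of "{0..1::real}" t s r] s t r by (simp add: algebra_simps)
        moreover have "\<bar>r * (s - t)\<bar> \<le> \<bar>s - t\<bar>"
          using r by (auto simp: abs_mult intro: mult_left_le_one_le)
        ultimately show "(\<gamma> t, Y t) + r *\<^sub>R ((\<gamma> s, Y t) - (\<gamma> t, Y t)) \<in> Q"
          unfolding Q_def diff by (intro image_eqI[where x = "t + r * (s - t)"]) (auto simp: \<gamma>_def algebra_simps)
      next
        fix z assume z: "z \<in> Q"
        then show "(c has_derivative blinfun_apply (D z)) (at z within Q)"
          using D Q by (meson has_derivative_subset subsetD)
        obtain r where r: "z = (\<gamma> r, Y t)" "\<bar>r - t\<bar> \<le> \<bar>s - t\<bar>" using z unfolding Q_def by auto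
        have "dist z (\<gamma> t, Y t) = \<bar>r - t\<bar> * norm h"
          by (simp add: r(1) dist_Pair_Pair \<gamma>_def dist_norm flip: scaleR_diff_left)
        also have "\<dots> \<le> \<bar>s - t\<bar> * (norm h + 1)" using r(2) by (intro mult_mono) auto
        also have "\<dots> < d'" using st h0 by (simp add: d_def pos_less_divide_eq)
        finally have "norm (D z - D (\<gamma> t, Y t)) < e'" using close z zQ Q by blast
        then show "onorm (blinfun_apply (D z) - blinfun_apply (D (\<gamma> t, Y t))) \<le> e'"
          by (simp add: norm_blinfun.rep_eq minus_blinfun.rep_eq fun_diff_def)
      qed (rule zQ)
      moreover have "norm ((\<gamma> s, Y t) - (\<gamma> t, Y t)) * e' \<le> e * \<bar>s - t\<bar>"
      proof -
        have "norm h * e' \<le> (norm h + 1) * e'" using e' by (intro mult_right_mono) auto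
        also have "\<dots> = e" using h0 by (simp add: e'_def)
        finally have "\<bar>s - t\<bar> * (norm h * e') \<le> \<bar>s - t\<bar> * e" by (intro mult_left_mono) auto
        then show ?thesis unfolding diff by (simp add: norm_Pair mult_ac)
      qed
      moreover have "blinfun_apply (D (\<gamma> t, Y t)) ((\<gamma> s, Y t) - (\<gamma> t, Y t)) = (s - t) * p t"
        unfolding diff p_def by (simp only: blinfun.scaleR_right real_scaleR_def)
      ultimately show ?thesis by (simp add: abs_le_iff)
    qed
    show "\<exists>d>0. \<forall>s\<in>{0..1}. \<forall>t\<in>{0..1}. \<bar>s - t\<bar> < d \<longrightarrow>
        \<phi>1 (\<gamma> s) - \<phi>1 (\<gamma> t) \<le> (s - t) * p t + e * \<bar>s - t\<bar> \<and>
        \<phi>2 (\<gamma> s) - \<phi>2 (\<gamma> t) \<le> (s - t) * p t + e * \<bar>s - t\<bar>"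
    proof (intro exI[of _ d] conjI d ballI impI)
      fix s t :: real assume st: "s \<in> {0..1}" "t \<in> {0..1}" "\<bar>s - t\<bar> < d"
      show "\<phi>1 (\<gamma> s) - \<phi>1 (\<gamma> t) \<le> (s - t) * p t + e * \<bar>s - t\<bar>"
        using expansion[OF st] le1[OF \<gamma>S[OF st(1)] Y[OF st(2)]] Y1[OF st(2)] by linarith
      show "\<phi>2 (\<gamma> s) - \<phi>2 (\<gamma> t) \<le> (s - t) * p t + e * \<bar>s - t\<bar>"
        using expansion[OF st] le2[OF \<gamma>S[OF st(1)] Y[OF st(2)]] Y2[OF st(2)] by linarith
    qed
  qed
  then show ?thesis by (simp add: \<gamma>_def h_def)
qed

section \<open>Uniqueness of potentials\<close>

theorem theorem4p5:
  fixes \<Omega> :: "'a::euclidean_space set"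
    and c :: "'a \<times> 'a \<Rightarrow> real"
    and \<rho> \<rho>' :: "'a measure"
    and \<phi>1 \<psi>1 \<phi>2 \<psi>2 :: "'a \<Rightarrow> real"
  assumes "compact \<Omega>"
    and "C1_on c (\<Omega> \<times> \<Omega>)"
    and "\<rho> \<in> prob_measures_on \<Omega>"
    and "\<rho>' \<in> prob_measures_on \<Omega>"
    and "supp \<rho> = closure (interior (supp \<rho>))"
    and "\<forall>A \<in> components (interior (supp \<rho>)). \<forall>B \<in> components (interior (supp \<rho>)).
           linked \<Omega> c \<rho> \<rho>' A B"
    and "(\<phi>1, \<psi>1) \<in> kantorovich_potentials \<Omega> c \<rho> \<rho>'"
    and "(\<phi>2, \<psi>2) \<in> kantorovich_potentials \<Omega> c \<rho> \<rho>'"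
  shows "\<exists>k. AE x in \<rho>. \<phi>2 x - \<phi>1 x = k"
proof -
  note \<Omega> = assms(1) and \<rho> = assms(3) and \<rho>' = assms(4) and pot1 = assms(7) and pot2 = assms(8)
  note D1 = kantorovich_potentialsD[OF pot1] and D2 = kantorovich_potentialsD[OF pot2]
  have c: "continuous_on (\<Omega> \<times> \<Omega>) c" by (rule C1_on_imp_continuous_on[OF assms(2)])
  define f where "f x = \<phi>2 x - \<phi>1 x" for x
  have cf: "continuous_on \<Omega> f" unfolding f_def by (intro continuous_intros D1 D2)
  let ?C = "components (interior (supp \<rho>))"
  have supp_\<Omega>: "supp \<rho> \<subseteq> \<Omega>" by (auto simp: supp_def space_prob_measures_on[OF \<rho>])
  have comp_supp: "closure A \<subseteq> supp \<rho>" if "A \<in> ?C" for A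
    using in_components_subset[OF that] assms(5) by (metis closure_mono)
  have contact: "\<exists>y\<in>\<Omega>. \<phi>1 x + \<psi>1 y = c (x, y) \<and> \<phi>2 x + \<psi>2 y = c (x, y)" if x: "x \<in> supp \<rho>" for x
  proof -
    obtain y where y: "y \<in> \<Omega>" "(\<phi>1 x + \<phi>2 x) / 2 + (\<psi>1 y + \<psi>2 y) / 2 = c (x, y)"
      using contact_point_exists[OF \<Omega> \<rho> c average_kantorovich_potentials[OF \<Omega> \<rho> \<rho>' pot1 pot2] x]
      by blast
    have "x \<in> \<Omega>" using x supp_\<Omega> by blast
    from D1(3)[OF this y(1)] D2(3)[OF this y(1)] y(2)
    have "\<phi>1 x + \<psi>1 y = c (x, y) \<and> \<phi>2 x + \<psi>2 y = c (x, y)" by argo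
    with y(1) show ?thesis by blast
  qed
  have const: "\<exists>k. \<forall>x\<in>closure A. f x = k" if A: "A \<in> ?C" for A
  proof -
    have "open A" by (rule open_components[OF open_interior A])
    have A_supp: "A \<subseteq> supp \<rho>" using comp_supp[OF A] closure_subset by blast
    have "f constant_on A"
    proof (rule locally_constant_imp_constant)
      show "connected A" by (rule in_components_connected[OF A])
      fix a assume a: "a \<in> A"
      obtain r where r: "r > 0" "ball a r \<subseteq> A" using \<open>open A\<close> a by (auto simp: open_contains_ball)
      have "f x = f a" if "x \<in> ball a r" for x
      proof -
        have seg: "closed_segment a x \<subseteq> supp \<rho>"
          using closed_segment_subset[OF centre_in_ball[THEN iffD2, OF r(1)] that convex_ball] r A_supp by blast
        have "\<phi>1 x - \<phi>1 a = \<phi>2 x - \<phi>2 a"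
          by (rule common_contact_imp_equal_increment[OF \<Omega> assms(2) D1(3) D2(3)])
            (use seg supp_\<Omega> contact in blast)+
        then show ?thesis by (simp add: f_def)
      qed
      moreover have "openin (top_of_set A) (ball a r)" using r(2) \<open>open A\<close> by (simp add: openin_open_eq)
      ultimately show "\<exists>T. openin (top_of_set A) T \<and> a \<in> T \<and> (\<forall>x\<in>T. f x = f a)"
        using r(1) by (metis centre_in_ball)
    qed
    then obtain k where k: "\<And>x. x \<in> A \<Longrightarrow> f x = k" by (auto simp: constant_on_def)
    have "continuous_on (closure A) f"
      using cf comp_supp[OF A] supp_\<Omega> by (meson continuous_on_subset order_trans)
    from continuous_constant_on_closure[OF this k] show ?thesis by blast
  qed
  then obtain k where k: "\<And>A x. A \<in> ?C \<Longrightarrow> x \<in> closure A \<Longrightarrow> f x = k A" by metis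
  \<comment> \<open>The closure in the definition of the target set is harmless: the pairs in contact for both
    potentials form a compact set, whose projection to the second factor is closed.\<close>
  have target: "\<exists>x\<in>closure A. f x = \<psi>1 y - \<psi>2 y" if A: "A \<in> ?C" and y: "y \<in> target_set \<Omega> c \<rho> \<rho>' A" for A y
  proof -
    let ?g1 = "\<lambda>z. \<phi>1 (fst z) + \<psi>1 (snd z) - c z" and ?g2 = "\<lambda>z. \<phi>2 (fst z) + \<psi>2 (snd z) - c z"
    let ?Z = "{z \<in> closure A \<times> \<Omega>. ?g1 z = 0} \<inter> {z \<in> closure A \<times> \<Omega>. ?g2 z = 0}"
    have A\<Omega>: "closure A \<subseteq> \<Omega>" using comp_supp[OF A] supp_\<Omega> by blast
    then have sub: "closure A \<times> \<Omega> \<subseteq> \<Omega> \<times> \<Omega>" by blast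
    have cl: "closed (closure A \<times> \<Omega>)" by (intro closed_Times closed_closure compact_imp_closed \<Omega>)
    have "continuous_on (closure A \<times> \<Omega>) ?g1" "continuous_on (closure A \<times> \<Omega>) ?g2"
      using A\<Omega> by (auto intro!: continuous_intros continuous_on_subset[OF c sub]
          continuous_on_compose2[OF D1(1)] continuous_on_compose2[OF D1(2)]
          continuous_on_compose2[OF D2(1)] continuous_on_compose2[OF D2(2)])
    then have "closed ?Z" by (intro closed_Int continuous_closed_preimage_constant cl)
    moreover have "bounded ?Z"
      by (rule bounded_subset[OF compact_imp_bounded[OF compact_Times[OF \<Omega> \<Omega>]]]) (use A\<Omega> in auto)
    ultimately have "compact ?Z" by (simp add: compact_eq_bounded_closed)
    then have "compact (snd ` ?Z)" by (intro compact_continuous_image continuous_on_snd continuous_on_id)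
    then have "closed (snd ` ?Z)" by (rule compact_imp_closed)
    moreover have "{y. \<exists>x \<pi>. x \<in> closure A \<and> \<pi> \<in> optimal_plans \<Omega> c \<rho> \<rho>' \<and> (x, y) \<in> supp \<pi>} \<subseteq> snd ` ?Z"
    proof
      fix y assume "y \<in> {y. \<exists>x \<pi>. x \<in> closure A \<and> \<pi> \<in> optimal_plans \<Omega> c \<rho> \<rho>' \<and> (x, y) \<in> supp \<pi>}"
      then obtain x \<pi> where xy: "x \<in> closure A" "\<pi> \<in> optimal_plans \<Omega> c \<rho> \<rho>'" "(x, y) \<in> supp \<pi>"
        by blast
      then have "\<pi> \<in> prob_measures_on (\<Omega> \<times> \<Omega>)" by (simp add: optimal_plans_def transport_plans_def)
      then have "y \<in> \<Omega>" using xy(3) by (auto simp: supp_def space_prob_measures_on)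
      with xy complementary_slackness[OF \<Omega> \<rho> \<rho>' c pot1 xy(2,3)]
        complementary_slackness[OF \<Omega> \<rho> \<rho>' c pot2 xy(2,3)]
      show "y \<in> snd ` ?Z" by (intro image_eqI[where x = "(x, y)"]) auto
    qed
    ultimately have "target_set \<Omega> c \<rho> \<rho>' A \<subseteq> snd ` ?Z"
      unfolding target_set_def by (intro closure_minimal)
    with y obtain x where "x \<in> closure A" "\<phi>1 x + \<psi>1 y = c (x, y)" "\<phi>2 x + \<psi>2 y = c (x, y)" by auto
    then show ?thesis by (intro bexI[of _ x]) (auto simp: f_def)
  qed
  \<comment> \<open>At a common target \<open>y\<close> the difference equals \<open>\<psi>1 y - \<psi>2 y\<close> in both components.\<close>
  have adjacent: "k A = k B"
    if AB: "A \<in> ?C" "B \<in> ?C" "target_set \<Omega> c \<rho> \<rho>' A \<inter> target_set \<Omega> c \<rho> \<rho>' B \<noteq> {}" for A B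
  proof -
    obtain y where y: "y \<in> target_set \<Omega> c \<rho> \<rho>' A" "y \<in> target_set \<Omega> c \<rho> \<rho>' B" using AB(3) by blast
    obtain x x' where "x \<in> closure A" "x' \<in> closure B" "f x = f x'"
      using target[OF AB(1) y(1)] target[OF AB(2) y(2)] by force
    with k[OF AB(1)] k[OF AB(2)] show ?thesis by simp
  qed
  have same: "k A = k B" if AB: "A \<in> ?C" "B \<in> ?C" for A B
  proof -
    have "linked \<Omega> c \<rho> \<rho>' A B" using assms(6) AB by simp
    then obtain Os where Os: "Os \<noteq> []" "set Os \<subseteq> ?C" "hd Os = A" "last Os = B"
      and link: "\<forall>j. Suc j < length Os \<longrightarrow>
        target_set \<Omega> c \<rho> \<rho>' (Os ! j) \<inter> target_set \<Omega> c \<rho> \<rho>' (Os ! Suc j) \<noteq> {}"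
      unfolding linked_def by (elim exE conjE) (rule that)
    have "k (Os ! j) = k A" if "j < length Os" for j
      using that
    proof (induction j)
      case 0
      then show ?case using Os by (simp add: hd_conv_nth)
    next
      case (Suc j)
      have "k (Os ! j) = k (Os ! Suc j)"
      proof (rule adjacent)
        show "Os ! j \<in> ?C" "Os ! Suc j \<in> ?C"
          using Os(2) Suc.prems nth_mem[of j Os] nth_mem[of "Suc j" Os] by (simp_all add: subset_iff)
      qed (rule link[rule_format, OF Suc.prems])
      with Suc show ?case by simp
    qed
    from this[of "length Os - 1"] show ?thesis using Os(1,4) by (simp add: last_conv_nth)
  qed
  have "\<exists>k0. \<forall>x\<in>interior (supp \<rho>). f x = k0"
  proof (cases "?C = {}")
    case True
    then show ?thesis by (simp add: components_eq_empty)
  next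
    case False
    then obtain A0 where A0: "A0 \<in> ?C" by blast
    have "f x = k A0" if "x \<in> interior (supp \<rho>)" for x
    proof -
      have "x \<in> \<Union> ?C" using that by (simp add: Union_components)
      then obtain A where "A \<in> ?C" "x \<in> A" by blast
      then show ?thesis using k[of A x] same[OF _ A0] closure_subset[of A] by auto
    qed
    then show ?thesis by blast
  qed
  then obtain k0 where k0: "\<And>x. x \<in> interior (supp \<rho>) \<Longrightarrow> f x = k0" by blast
  have "continuous_on (closure (interior (supp \<rho>))) f"
    using cf supp_\<Omega> assms(5) by (metis continuous_on_subset)
  then have "f x = k0" if "x \<in> supp \<rho>" for x
    using continuous_constant_on_closure[of "interior (supp \<rho>)" f k0 x] k0 that assms(5) by simp
  then have "AE x in \<rho>. \<phi>2 x - \<phi>1 x = k0"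
    using AE_in_supp[OF \<rho>] unfolding f_def by auto
  then show ?thesis by blast
qed

end
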